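(* Let $p_1,p_2$ be primes, one of which is congruent to $1$ and the other to $3$ modulo $4$, let $m\ge1$ be an integer and $N=p_1^mp_2$. Let $p$ be a prime with $\gcd(p,N)=1$ such that $\mathrm{ord}_{p_1^m}(p)=\phi(p_1^m)$, $\mathrm{ord}_{p_2}(p)=\phi(p_2)$ and $f:=\mathrm{ord}_N(p)=\phi(N)/2$, and let $q=p^f$. Let $\gamma$ be a fixed primitive element of the finite field $\mathbb{F}_q$, let $C_0=\langle\gamma^N\rangle$ be the subgroup of $\mathbb{F}_q^*$ of index $N$, let $C_i=\gamma^iC_0$ (with indices $i$ read modulo $N$), and put $$D=\bigcup_{i=0}^{p_1^{m-1}-1}C_{ip_2}.$$ Let $\chi_1,\chi_2$ be the multiplicative characters of $\mathbb{F}_q$ of orders $p_1^m$ and $p_2$ defined by $\chi_1(\gamma)=\exp(2\pi\sqrt{-1}/p_1^m)$ and $\chi_2(\gamma)=\exp(2\pi\sqrt{-1}/p_2)$. Let $h$ be the class number of $\mathbb{Q}(\sqrt{-p_1p_2})$, let $h_0=\frac{f-h}{2}$, and let $b,c$ be the integers such that $$g(\bar\chi_1\bar\chi_2)=\frac{b+c\sqrt{-p_1p_2}}{2}\,p^{h_0},$$ where $b,c\not\equiv0\pmod p$, $b^2+p_1p_2c^2=4p^h$, and $b\equiv 2p^{h/2}\pmod \ell$, with $\ell\in\{p_1,p_2\}$ the prime congruent to $3$ modulo $4$. Then $\mathrm{Cay}(\mathbb{F}_q,D)$ is a strongly regular graph if and only if $b,c\in\{1,-1\}$, $h$ is even, and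 $$p_1=2p^{h/2}+(-1)^{\frac{p_1-1}{2}}b,\qquad p_2=2p^{h/2}-(-1)^{\frac{p_1-1}{2}}b.$$
   Context: $\phi$ is Euler's totient function and $\mathrm{ord}_n(p)$ is the multiplicative order of $p$ modulo $n$. All graphs are simple and undirected. For $D\subset\mathbb{F}_q$ with $-D=D$ and $0\notin D$ (which holds for the set $D$ in the claim, since $-C_i=C_i$ for all $i$), $\mathrm{Cay}(\mathbb{F}_q,D)$ is the graph with vertex set $\mathbb{F}_q$ in which two vertices are adjacent if and only if their difference belongs to $D$. A strongly regular graph with parameters $(v,k,\lambda,\mu)$ is a graph with $v$ vertices, not complete or edgeless, that is regular of valency $k$, in which any two adjacent vertices have exactly $\lambda$ common neighbours and any two distinct nonadjacent vertices have exactly $\mu$ common neighbours; a graph is strongly regular if it is so for some such parameters. Gauss sums: let $\xi_p$ be a fixed complex primitive $p$-th root of unity and $\psi(x)=\xi_p^{\mathrm{Tr}_{q/p}(x)}$ for $x\in\mathbb{F}_q$, where $\mathrm{Tr}_{q/p}$ is the trace from $\mathbb{F}_q$ to $\mathbb{Z}/p\mathbb{Z}$. For a multiplicative character $\chi$ of $\mathbb{F}_q^*$, $g(\chi)=\sum_{a\in\mathbb{F}_q^*}\chi(a)\psi(a)$, and $\bar\chi=\chi^{-1}$. The existence of integers $b,c$ with the listed properties is a theorem of Mbodj: if $N=p_1^mp_2$ with $m\ge1$ an integer and $p_1,p_2$ primes, one congruent to $1$ and the other to $3$ modulo $4$, if $p$ is a prime with $\gcd(p,N)=1$, $\mathrm{ord}_{p_1^m}(p)=\phi(p_1^m)$,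 $\mathrm{ord}_{p_2}(p)=\phi(p_2)$ and $f:=\mathrm{ord}_N(p)=\phi(N)/2$ (that is, the subgroup $\langle p\rangle$ generated by $p$ has index $2$ in $(\mathbb{Z}/N\mathbb{Z})^*$), if $q=p^f$, and if $h$ is the class number of $\mathbb{Q}(\sqrt{-p_1p_2})$, then for any multiplicative character $\chi$ of order $N$ of $\mathbb{F}_q$, the Gauss sum $g(\chi)$ is determined up to complex conjugation by $g(\chi)=\frac{b+c\sqrt{-p_1p_2}}{2}p^{h_0}$ with $h_0=\frac{f-h}{2}$, $b,c\not\equiv0\pmod p$, $b^2+p_1p_2c^2=4p^h$, and $b\equiv2p^{h/2}\pmod\ell$, where $\ell\in\{p_1,p_2\}$ is the prime congruent to $3$ modulo $4$. *)

theory Defs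
  imports "HOL-Computational_Algebra.Polynomial" "HOL-Number_Theory.Number_Theory" "HOL-Algebra.Ideal"
begin

section \<open>Finite fields, characters and Gauss sums\<close>

text \<open>A finite field is a type of class \<open>finite\<close> and \<open>field\<close>.\<close>

definition primitive_element :: "'a :: {finite, field} \<Rightarrow> bool" where
  "primitive_element \<gamma> \<longleftrightarrow> \<gamma> \<noteq> 0 \<and> (\<forall>x. x \<noteq> 0 \<longrightarrow> (\<exists>k::nat. x = \<gamma> ^ k))"

text \<open>The coset \<open>C\<^sub>i = \<gamma>\<^sup>i \<langle>\<gamma>\<^sup>N\<rangle>\<close>. The field is finite, so the nonnegative powers
  of \<open>\<gamma>\<^sup>N\<close> already form the subgroup it generates.\<close>

definition cyclotomic_class :: "'a :: {finite, field} \<Rightarrow> nat \<Rightarrow> nat \<Rightarrow> 'a set" where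
  "cyclotomic_class \<gamma> N i = {\<gamma> ^ i * (\<gamma> ^ N) ^ k | k :: nat. True}"

text \<open>Multiplicative characters are functions on the whole field of which only the values at
  nonzero arguments matter.\<close>

definition multiplicative_character :: "('a :: {finite, field} \<Rightarrow> complex) \<Rightarrow> bool" where
  "multiplicative_character chi \<longleftrightarrow>
     (\<forall>x. x \<noteq> 0 \<longrightarrow> chi x \<noteq> 0) \<and>
     (\<forall>x y. x \<noteq> 0 \<longrightarrow> y \<noteq> 0 \<longrightarrow> chi (x * y) = chi x * chi y)"

definition primitive_root_of_unity :: "nat \<Rightarrow> complex \<Rightarrow> bool" where
  "primitive_root_of_unity n \<xi> \<longleftrightarrow> \<xi> ^ n = 1 \<and> (\<forall>k. 0 < k \<and> k < n \<longrightarrow> \<xi> ^ k \<noteq> 1)"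

text \<open>In a field with \<open>p ^ f\<close> elements, the next function is the trace to the prime field,
  which is the set of all \<open>of_nat k\<close> with \<open>k < p\<close>.\<close>

definition absolute_trace :: "nat \<Rightarrow> nat \<Rightarrow> 'a :: {finite, field} \<Rightarrow> 'a" where
  "absolute_trace p f x = (\<Sum>i<f. x ^ (p ^ i))"

definition additive_character ::
    "nat \<Rightarrow> nat \<Rightarrow> complex \<Rightarrow> 'a :: {finite, field} \<Rightarrow> complex" where
  "additive_character p f \<xi> x = \<xi> ^ (THE k. k < p \<and> of_nat k = absolute_trace p f x)"

definition gauss_sum ::
    "nat \<Rightarrow> nat \<Rightarrow> complex \<Rightarrow> ('a :: {finite, field} \<Rightarrow> complex) \<Rightarrow> complex" where
  "gauss_sum p f \<xi> chi = (\<Sum>a\<in>UNIV - {0}. chi a * additive_character p f \<xi> a)"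


section \<open>Class numbers\<close>

text \<open>Number fields are represented as subsets of the complex numbers.\<close>

definition quadratic_field :: "int \<Rightarrow> complex set" where
  "quadratic_field d = {of_rat a + of_rat b * csqrt (of_int d) | a b. True}"

definition ring_of_integers :: "complex set \<Rightarrow> complex ring" where
  "ring_of_integers K =
     \<lparr>carrier = {x \<in> K. algebraic_int x}, mult = (*), one = 1, zero = 0, add = (+)\<rparr>"

definition nonzero_ideals :: "complex set \<Rightarrow> complex set set" where
  "nonzero_ideals K = {I. ideal I (ring_of_integers K) \<and> I \<noteq> {0}}"

text \<open>Every fractional ideal is a scalar multiple of an integral one, so the ideal class group is
  the set of nonzero integral ideals modulo \<open>I \<sim> J \<longleftrightarrow> aI = bJ\<close> for some nonzero integers
  \<open>a, b\<close> of \<open>K\<close>.\<close>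

definition ideal_class_rel :: "complex set \<Rightarrow> (complex set \<times> complex set) set" where
  "ideal_class_rel K = {(I, J). I \<in> nonzero_ideals K \<and> J \<in> nonzero_ideals K \<and>
     (\<exists>a \<in> carrier (ring_of_integers K) - {0}. \<exists>b \<in> carrier (ring_of_integers K) - {0}.
        (\<lambda>x. a * x) ` I = (\<lambda>x. b * x) ` J)}"

definition class_number :: "complex set \<Rightarrow> nat" where
  "class_number K = card (nonzero_ideals K // ideal_class_rel K)"


section \<open>Strongly regular graphs and Cayley graphs\<close>

text \<open>A graph is given by a vertex set and an adjacency relation.\<close>

definition simple_graph :: "'v set \<Rightarrow> ('v \<Rightarrow> 'v \<Rightarrow> bool) \<Rightarrow> bool" where
  "simple_graph V E \<longleftrightarrow> (\<forall>x\<in>V. \<not> E x x) \<and> (\<forall>x\<in>V. \<forall>y\<in>V. E x y \<longrightarrow> E y x)"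

definition strongly_regular_params ::
    "'v set \<Rightarrow> ('v \<Rightarrow> 'v \<Rightarrow> bool) \<Rightarrow> nat \<Rightarrow> nat \<Rightarrow> nat \<Rightarrow> nat \<Rightarrow> bool" where
  "strongly_regular_params V E v k l \<mu> \<longleftrightarrow>
     finite V \<and> card V = v \<and> simple_graph V E \<and>
     (\<exists>x\<in>V. \<exists>y\<in>V. x \<noteq> y \<and> \<not> E x y) \<and>
     (\<exists>x\<in>V. \<exists>y\<in>V. E x y) \<and>
     (\<forall>x\<in>V. card {z \<in> V. E x z} = k) \<and>
     (\<forall>x\<in>V. \<forall>y\<in>V. E x y \<longrightarrow> card {z \<in> V. E x z \<and> E y z} = l) \<and>
     (\<forall>x\<in>V. \<forall>y\<in>V. x \<noteq> y \<and> \<not> E x y \<longrightarrow> card {z \<in> V. E x z \<and> E y z} = \<mu>)"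

definition strongly_regular :: "'v set \<Rightarrow> ('v \<Rightarrow> 'v \<Rightarrow> bool) \<Rightarrow> bool" where
  "strongly_regular V E \<longleftrightarrow> (\<exists>v k l \<mu>. strongly_regular_params V E v k l \<mu>)"

definition cayley_adj :: "'a :: ab_group_add set \<Rightarrow> 'a \<Rightarrow> 'a \<Rightarrow> bool" where
  "cayley_adj D x y \<longleftrightarrow> x - y \<in> D"

end

theory Submission
  imports Defs "HOL-Library.Cardinality"
begin

text \<open>
  The Cayley graph is strongly regular iff the character sums \<open>\<psi>(\<gamma>\<^sup>a D)\<close> are the roots of one
  quadratic equation. Expanding the indicator function of \<open>D\<close> in characters of order dividing \<open>N\<close>,
  only the characters that are trivial or of full order on the \<open>p\<^sub>1\<close>-part survive. Their Gauss sums
  are \<open>\<plusminus>\<surd>q\<close> when one of the two components is trivial (then \<open>-1\<close> is a power of \<open>p\<close> modulo the order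
  and the sum is real), and otherwise equal to the given Gauss sum or its complex conjugate, because
  \<open>-1\<close> represents the nontrivial class modulo \<open>\<langle>p\<rangle>\<close>. The result is a list of four types of
  eigenvalues, one of which involves \<open>c\<close> with both signs. Two-valuedness then forces three linear
  relations, which together with the norm equation give the theorem.

  The signs of the two real Gauss sums follow from the integrality of the eigenvalues; of the
  quadratic Gauss sums only the product of two, up to sign, enters.
\<close>

section \<open>Exponential sums over units modulo a prime power\<close>

text \<open>The shape of \<open>D\<close> makes the exponent \<open>m\<close> disappear. The shifts
  \<open>i * p2\<close> with \<open>i < p1 ^ r\<close> represent every residue modulo
  \<open>p1 ^ r\<close> once, and all sums over units modulo \<open>M\<close> vanish unless
  \<open>p1 ^ r\<close> divides the argument. So exactly one shift contributes, and the factor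
  \<open>p1 ^ r\<close> cancels against \<open>N\<close>. Two pieces of sign information are
  obtained indirectly. For the real Gauss sums: \<open>p - 1\<close> is coprime to \<open>N\<close>,
  so \<open>D\<close> is stable under the nonzero elements of the prime field and
  \<open>p - 1\<close> times each eigenvalue is an integer. Since the explicit formula is for
  \<open>p1 * p2\<close> times the eigenvalue, it yields congruences modulo \<open>p1\<close> and
  \<open>p2\<close> that leave one choice of signs. For the quadratic Gauss sums: there are two
  exponents at which their product takes opposite values, so both signs of \<open>c\<close> occur
  among the eigenvalues in any case.\<close>

lemma primitive_root_power_eq_1_iff:
  assumes "primitive_root_of_unity n w" "n > 0"
  shows "w ^ k = 1 \<longleftrightarrow> n dvd k"
proof -
  have w: "w ^ n = 1" and *: "\<And>k. 0 < k \<Longrightarrow> k < n \<Longrightarrow> w ^ k \<noteq> 1"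
    using assms by (auto simp: primitive_root_of_unity_def)
  have "w ^ k = w ^ (k div n * n + k mod n)" by simp
  also have "\<dots> = w ^ (k mod n)"
    unfolding power_add power_mult mult.commute[of "k div n"] by (simp add: w)
  finally have "w ^ k = 1 \<longleftrightarrow> w ^ (k mod n) = 1" by simp
  also have "\<dots> \<longleftrightarrow> k mod n = 0" using *[of "k mod n"] assms(2) by (cases "k mod n = 0") auto
  finally show ?thesis by (simp add: dvd_eq_mod_eq_0)
qed

lemma primitive_root_nonzero: "primitive_root_of_unity n w \<Longrightarrow> n > 0 \<Longrightarrow> w \<noteq> 0"
  by (auto simp: primitive_root_of_unity_def power_0_left)

lemma primitive_root_power_eq_iff:
  assumes "primitive_root_of_unity n w" "n > 0"
  shows "w ^ j = w ^ k \<longleftrightarrow> [j = k] (mod n)"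
proof (induction j k rule: linorder_wlog)
  case (le j k)
  have "w ^ k = w ^ j * w ^ (k - j)" using le by (simp flip: power_add)
  hence "w ^ j = w ^ k \<longleftrightarrow> w ^ (k - j) = 1" using primitive_root_nonzero[OF assms] by auto
  also have "\<dots> \<longleftrightarrow> n dvd k - j" using primitive_root_power_eq_1_iff[OF assms] .
  also have "\<dots> \<longleftrightarrow> [j = k] (mod n)" using le by (metis cong_altdef_nat cong_sym_eq)
  finally show ?case .
next
  case (sym j k)
  then show ?case by (metis cong_sym_eq)
qed

lemma primitive_root_power:
  assumes "primitive_root_of_unity (d * e) w" "d > 0" "e > 0"
  shows "primitive_root_of_unity e (w ^ d)"
proof -
  have "(w ^ d) ^ k = 1 \<longleftrightarrow> e dvd k" for k
    using primitive_root_power_eq_1_iff[OF assms(1), of "d * k"] assms by (simp add: power_mult)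
  thus ?thesis by (auto simp: primitive_root_of_unity_def dest: dvd_imp_le)
qed

lemma primitive_root_exp:
  assumes "n > 0"
  shows "primitive_root_of_unity n (exp (2 * of_real pi * \<i> / of_nat n))"
proof -
  have *: "exp (2 * of_real pi * \<i> / of_nat n) ^ k = cis (2 * pi * k / n)" for k
    by (simp add: exp_of_nat_mult[symmetric] cis_conv_exp algebra_simps)
  have "cis (2 * pi * k / n) \<noteq> 1" if k: "0 < k" "k < n" for k
  proof
    assume "cis (2 * pi * k / n) = 1"
    hence "cos (2 * pi * k / n) = 1" by (metis cis.simps(1) one_complex.simps(1))
    then obtain x :: int where "2 * pi * k / n = of_int x * 2 * pi"
      by (auto simp: cos_one_2pi_int)
    hence "real k = of_int x * real n" using assms by (simp add: field_simps)
    hence "int k = x * int n" by (metis of_int_eq_iff of_int_mult of_int_of_nat_eq)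
    thus False using k by (metis dvd_triv_right int_dvd_int_iff nat_dvd_not_less)
  qed
  moreover have "cis (2 * pi * n / n) = 1" using assms by simp
  ultimately show ?thesis unfolding primitive_root_of_unity_def * by blast
qed

lemma root_of_unity_norm:
  fixes w :: complex
  assumes "w ^ n = 1" "n > 0"
  shows "norm w = 1"
  by (metis assms norm_one norm_power norm_ge_zero power_eq_1_iff less_numeral_extra(3))

lemma norm_1_mult_cnj: "norm (z :: complex) = 1 \<Longrightarrow> z * cnj z = 1"
  by (simp add: complex_norm_square[symmetric])

lemma sum_powers_root_of_unity:
  fixes z :: complex
  assumes "z ^ n = 1"
  shows "(\<Sum>u<n. z ^ u) = (if z = 1 then of_nat n else 0)"
  using assms by (simp add: sum_gp_strict)

lemma sum_lessThan_mult_periodic: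
  fixes F :: "nat \<Rightarrow> 'a :: semiring_1"
  assumes "\<And>s. F (s + d) = F s"
  shows "(\<Sum>s<a * d. F s) = of_nat a * (\<Sum>s<d. F s)"
proof (induction a)
  case (Suc a)
  have per: "F (s + a * d) = F s" for s
    by (induction a) (simp_all add: add.assoc[symmetric] assms add.commute[of d])
  have "(\<Sum>s<Suc a * d. F s) = (\<Sum>s<a * d. F s) + (\<Sum>s=a * d..<a * d + d. F s)"
    by (metis add.commute atLeast0LessThan le_add1 mult_Suc sum.atLeastLessThan_concat zero_le)
  also have "(\<Sum>s=a * d..<a * d + d. F s) = (\<Sum>s<d. F s)"
    using sum.shift_bounds_nat_ivl[of F 0 "a * d" d] by (simp add: atLeast0LessThan per add.commute)
  finally show ?case using Suc by (simp add: algebra_simps)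
qed simp

text \<open>For a primitive root \<open>g\<close> modulo an odd prime power and \<open>L\<close> the
  number of units, \<open>(-1) ^ s\<close> is the quadratic character at \<open>g ^ s\<close>, so
  this is a quadratic Gauss sum written in the discrete logarithm \<open>s\<close>.\<close>

definition quadratic_sum :: "nat \<Rightarrow> nat \<Rightarrow> complex \<Rightarrow> nat \<Rightarrow> complex" where
  "quadratic_sum L g w k = (\<Sum>s<L. (-1) ^ s * w ^ (g ^ s * k))"

text \<open>Used with \<open>g = p\<close> for both moduli \<open>M\<close> and \<open>p2\<close>.
  The exponent \<open>Suc r\<close> makes the number \<open>P ^ r\<close>, at whose multiples the
  sums concentrate, available without subtraction.\<close>

locale primitive_root_prime_power =
  fixes P r g n :: nat and w :: complex
  assumes P: "prime P" "odd P"
    and n: "n = P ^ Suc r"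
    and g: "ord n g = totient n"
    and w: "primitive_root_of_unity n w"
begin

abbreviation "L \<equiv> totient n"
abbreviation "A \<equiv> quadratic_sum L g w"

lemma P_ge_3: "P \<ge> 3"
  using P prime_ge_2_nat[of P] by (cases "P = 2") auto

lemma n_gt_2: "n > 2"
proof -
  have "P \<le> n" using P_ge_3 unfolding n by (intro dvd_imp_le) auto
  thus ?thesis using P_ge_3 by simp
qed

lemma P_dvd_n: "P dvd n" unfolding n by simp

lemma n_pos: "n > 0" using n_gt_2 by simp

lemma L_eq: "L = P ^ r * (P - 1)"
  unfolding n using P totient_prime_power_Suc by blast

lemma even_L: "even L" using P L_eq by auto

lemma L_pos: "L > 0" using n_gt_2 by simp

lemma coprime_g: "coprime n g"
  using g L_pos by (metis ord_gt_0_iff)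

lemma primroot: "residue_primroot n g"
  using g coprime_g n_pos by (simp add: residue_primroot_def)

lemma bij_powers: "bij_betw (\<lambda>s. g ^ s mod n) {..<L} {u. u < n \<and> \<not> P dvd u}"
proof -
  have "totatives n = {u. u < n \<and> \<not> P dvd u}"
  proof -
    have "coprime u n \<longleftrightarrow> \<not> P dvd u" for u
      unfolding n coprime_power_right_iff using prime_imp_coprime[OF P(1), of u] P(1)
      by (auto simp: coprime_commute dest: coprime_common_divisor_nat)
    moreover have "u \<noteq> n" if "coprime u n" for u using that n_gt_2 by auto
    moreover have "u \<noteq> 0" if "coprime u n" for u using that n_gt_2 by (cases "u = 0") auto
    ultimately show ?thesis 
      by (auto simp: totatives_def order.order_iff_strict) 
  qed
  thus ?thesis using residue_primroot_is_generator[OF _ primroot] n_gt_2 by auto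
qed

lemma power_cong_iff: "[g ^ s = g ^ t] (mod n) \<longleftrightarrow> [s = t] (mod L)"
  using order_divides_expdiff[of n g s t] coprime_g g by simp

lemma w_power_cong: "[j = k] (mod n) \<Longrightarrow> w ^ j = w ^ k"
  using primitive_root_power_eq_iff[OF w] n_gt_2 by simp

text \<open>The unit \<open>n - 1\<close> is some \<open>g ^ t\<close>; its square is 1, so
  \<open>L\<close> divides \<open>2 * t\<close>, and \<open>0 < t < L\<close> leaves only
  \<open>L div 2\<close>. The form with \<open>+ 1\<close> expresses a congruence to -1 over the
  naturals.\<close>

lemma g_half_cong: "[g ^ (L div 2) + 1 = 0] (mod n)"
proof -
  have "\<not> P dvd n - 1"
  proof
    assume "P dvd n - 1"
    with P_dvd_n have "P dvd n - (n - 1)" by (metis dvd_diff_nat)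
    moreover have "n - (n - 1) = 1" using n_gt_2 by simp
    ultimately show False using P by simp
  qed
  hence "n - 1 \<in> {u. u < n \<and> \<not> P dvd u}" using n_gt_2 by auto
  then obtain t where t: "t < L" "g ^ t mod n = n - 1"
    using bij_powers unfolding bij_betw_def by (metis (no_types, lifting) imageE lessThan_iff)
  have "[g ^ t + 1 = (n - 1) + 1] (mod n)"
    using t n_gt_2 by (intro cong_add cong_refl) (simp add: cong_def)
  hence c: "[g ^ t + 1 = 0] (mod n)" using n_pos by (simp add: cong_def)
  \<comment> \<open>The second factor stands for \<open>g ^ t - 1\<close>, so the product is
    \<open>g ^ (2 * t) - 1\<close> modulo \<open>n\<close>.\<close>
  hence "[(g ^ t + 1) * (g ^ t + (n - 1)) = 0 * (g ^ t + (n - 1))] (mod n)" by (rule cong_scalar_right)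
  hence "[g ^ t * (g ^ t) + g ^ t * n + (n - 1) = 0] (mod n)" 
    using n_gt_2 by (simp add: algebra_simps)
  hence "[g ^ t * g ^ t + g ^ t * n + (n - 1) + 1 = 0 + 1] (mod n)" by (rule cong_add) simp
  hence "[g ^ t * g ^ t + (g ^ t + 1) * n = 1] (mod n)" using n_gt_2 by (simp add: algebra_simps)
  hence "[g ^ t * g ^ t = 1] (mod n)" unfolding cong_def mod_mult_self1 .
  hence "[g ^ (2 * t) = 1] (mod n)" by (simp add: mult_2 power_add)
  hence d: "L dvd 2 * t" using ord_divides[of g "2*t" n] g by simp
  have "t \<noteq> 0"
  proof
    assume "t = 0"
    hence "1 mod n = n - 1" using t by simp
    thus False using n_gt_2 by auto
  qed
  then obtain j where j: "2 * t = L * j" using d by auto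
  hence "L * j < L * 2" using t(1) by linarith
  hence "j < 2" by simp
  moreover have "j \<noteq> 0" using j \<open>t \<noteq> 0\<close> by (intro notI) simp
  ultimately have "j = 1" by auto
  hence "t = L div 2" using j by simp
  thus ?thesis using c by simp
qed

section \<open>Splitting residues into units and multiples of the prime\<close>

lemma sum_lessThan_units:
  "(\<Sum>u<n. F u) = (\<Sum>s<L. F (g ^ s mod n)) + (\<Sum>u | u < n \<and> P dvd u. F u)"
proof -
  have "(\<Sum>u<n. F u) = (\<Sum>u | u < n \<and> \<not> P dvd u. F u) + (\<Sum>u | u < n \<and> P dvd u. F u)"
    by (subst sum.union_disjoint[symmetric]) (auto intro!: sum.cong)
  thus ?thesis using sum.reindex_bij_betw[OF bij_powers, of F] by simp
qed

lemma sum_units: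
  "(\<Sum>s<L. w ^ (g ^ s * k)) = (\<Sum>u | u < n \<and> \<not> P dvd u. w ^ (u * k))"
proof -
  have "(\<Sum>u | u < n \<and> \<not> P dvd u. w ^ (u * k)) = (\<Sum>s<L. w ^ ((g ^ s mod n) * k))"
    using sum.reindex_bij_betw[OF bij_powers, of "\<lambda>u. w ^ (u * k)"] by simp
  also have "\<dots> = (\<Sum>s<L. w ^ (g ^ s * k))"
    by (intro sum.cong refl w_power_cong) (auto simp: cong_def mod_mult_left_eq)
  finally show ?thesis ..
qed

text \<open>The sum over units is the sum over all residues minus the sum over the multiples of
  \<open>P\<close>; both are geometric, with ratios of order dividing \<open>n\<close> and
  \<open>P ^ r\<close>.\<close>

lemma ramanujan_sum:
  "(\<Sum>s<L. w ^ (g ^ s * k)) =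
     (if n dvd k then of_nat n else 0) - (if P ^ r dvd k then of_nat (P ^ r) else 0)"
proof -
  have n0: "n > 0" using n_gt_2 by simp
  have full: "(\<Sum>u<n. w ^ (u * k)) = (if n dvd k then of_nat n else 0)"
  proof -
    have "(\<Sum>u<n. w ^ (u * k)) = (\<Sum>u<n. (w ^ k) ^ u)"
      by (simp add: power_mult[symmetric] mult.commute)
    also have "\<dots> = (if w ^ k = 1 then of_nat n else 0)"
      using w by (intro sum_powers_root_of_unity)
        (simp add: primitive_root_of_unity_def power_mult[symmetric] mult.commute[of k] power_mult)
    finally show ?thesis using primitive_root_power_eq_1_iff[OF w n0] by simp
  qed
  have "P * P ^ r = n" using n by simp
  hence wP: "primitive_root_of_unity (P ^ r) (w ^ P)"
    using primitive_root_power[of P "P ^ r" w] w P prime_gt_0_nat[OF P(1)] by simp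
  have mult: "(\<Sum>u | u < n \<and> P dvd u. w ^ (u * k)) = (if P ^ r dvd k then of_nat (P ^ r) else 0)"
  proof -
    have "{u. u < n \<and> P dvd u} = (\<lambda>y. P * y) ` {..<P ^ r}"
      using prime_gt_0_nat[OF P(1)] unfolding n by (auto elim!: dvdE)
    hence "(\<Sum>u | u < n \<and> P dvd u. w ^ (u * k)) = (\<Sum>y<P ^ r. w ^ (P * y * k))"
      using prime_gt_0_nat[OF P(1)] by (simp add: sum.reindex inj_on_def)
    also have "\<dots> = (\<Sum>y<P ^ r. ((w ^ P) ^ k) ^ y)"
      by (simp add: power_mult[symmetric] mult_ac)
    also have "\<dots> = (if (w ^ P) ^ k = 1 then of_nat (P ^ r) else 0)"
      using wP by (intro sum_powers_root_of_unity)
       (metis mult.commute power_mult power_one primitive_root_of_unity_def)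
    finally show ?thesis using primitive_root_power_eq_1_iff[OF wP] prime_gt_0_nat[OF P(1)] by simp
  qed
  have "(\<Sum>u<n. w ^ (u * k)) = (\<Sum>u | u < n \<and> \<not> P dvd u. w ^ (u * k)) + (\<Sum>u | u < n \<and> P dvd u. w ^ (u * k))"
    by (subst sum.union_disjoint[symmetric]) (auto intro!: sum.cong)
  hence "(\<Sum>u | u < n \<and> \<not> P dvd u. w ^ (u * k)) =
      (\<Sum>u<n. w ^ (u * k)) - (\<Sum>u | u < n \<and> P dvd u. w ^ (u * k))" by simp
  thus ?thesis unfolding sum_units full mult .
qed

section \<open>Quadratic Gauss sums modulo a prime power\<close>

lemma quadratic_sum_cong: "[j = k] (mod n) \<Longrightarrow> A j = A k"
  unfolding quadratic_sum_def
  by (intro sum.cong arg_cong2[where f="(*)"] refl w_power_cong cong_scalar_left)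

text \<open>Multiplication by \<open>g\<close> is a cyclic shift of \<open>s\<close>, which costs
  one sign; the term that wraps around fits because \<open>L\<close> is even.\<close>

lemma quadratic_sum_g: "A (g * k) = - A k"
proof -
  define F where "F s = (-1) ^ s * w ^ (g ^ s * k)" for s
  have "[g ^ L * k = 1 * k] (mod n)"
    using ord_divides[of g L n] g by (intro cong_scalar_right) simp
  hence "w ^ (g ^ L * k) = w ^ k" using w_power_cong by simp
  hence FL: "F L = F 0" using even_L by (simp add: F_def)
  have "A (g * k) = (\<Sum>s<L. - F (Suc s))"
    unfolding quadratic_sum_def F_def by (intro sum.cong) (simp_all add: mult_ac)
  also have "\<dots> = - (\<Sum>s<L. F (Suc s))" by (simp add: sum_negf)
  also have "(\<Sum>s<L. F (Suc s)) + F 0 = (\<Sum>s<L. F s) + F L"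
    using sum.lessThan_Suc_shift[of F L] by (simp add: add.commute)
  hence "(\<Sum>s<L. F (Suc s)) = (\<Sum>s<L. F s)" using FL by simp
  finally show ?thesis by (simp add: F_def quadratic_sum_def)
qed

lemma quadratic_sum_g_power: "A (g ^ t * k) = (-1) ^ t * A k"
  by (induction t) (simp_all add: quadratic_sum_g mult.assoc)

lemma cnj_w_power: "cnj (w ^ k) = w ^ (g ^ (L div 2) * k)"
proof -
  have "[(g ^ (L div 2) + 1) * k = 0 * k] (mod n)" by (intro cong_scalar_right g_half_cong)
  hence "w ^ (g ^ (L div 2) * k + k) = w ^ 0" by (intro w_power_cong) (simp add: algebra_simps)
  hence "w ^ (g ^ (L div 2) * k) * w ^ k = 1" by (simp add: power_add)
  moreover have "norm w = 1" using w n_gt_2 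
    by (intro root_of_unity_norm[of w n]) (auto simp: primitive_root_of_unity_def)
  hence "w ^ k * cnj (w ^ k) = 1" by (intro norm_1_mult_cnj) (simp add: norm_power)
  ultimately show ?thesis by (metis mult.commute mult.left_commute mult.right_neutral)
qed

text \<open>Conjugation negates the exponent of \<open>w\<close>, that is, it shifts
  \<open>s\<close> by \<open>L div 2\<close>. The parity of \<open>L div 2\<close> thus decides
  between real and purely imaginary.\<close>

lemma cnj_quadratic_sum: "cnj (A k) = (-1) ^ (L div 2) * A k"
proof -
  have "cnj (A k) = (\<Sum>s<L. (-1) ^ s * cnj (w ^ (g ^ s * k)))"
    by (simp add: quadratic_sum_def)
  also have "\<dots> = A (g ^ (L div 2) * k)"
    unfolding cnj_w_power quadratic_sum_def by (simp add: mult_ac)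
  finally show ?thesis by (simp add: quadratic_sum_g_power)
qed

text \<open>The sequences in \<open>k\<close> belonging to distinct \<open>s\<close> are orthogonal,
  because the roots \<open>w ^ (g ^ s)\<close> for \<open>s < L\<close> are distinct; only the
  diagonal of length \<open>L\<close> remains.\<close>

lemma quadratic_sum_parseval: "(\<Sum>k<n. A k * cnj (A k)) = of_nat (n * L)"
proof -
  have wn: "norm w = 1" using w n_gt_2 
    by (intro root_of_unity_norm[of w n]) (auto simp: primitive_root_of_unity_def)
  have inner: "(\<Sum>k<n. w ^ (g ^ s * k) * cnj (w ^ (g ^ t * k))) = (if s = t then of_nat n else 0)"
    if "s < L" "t < L" for s t
  proof -
    define z where "z = w ^ (g ^ s) * cnj (w ^ (g ^ t))"
    have "z ^ n = 1" using w by (auto simp: z_def power_mult_distrib primitive_root_of_unity_def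
       power_mult[symmetric] mult.commute[of _ n] complex_cnj_power[symmetric] simp del: complex_cnj_power)
         (simp_all add: power_mult)
    moreover have "z = 1 \<longleftrightarrow> s = t"
    proof -
      have "w ^ (g ^ t) * cnj (w ^ (g ^ t)) = 1"
        by (rule norm_1_mult_cnj) (simp add: norm_power wn)
      hence "z = 1 \<longleftrightarrow> w ^ (g ^ s) = w ^ (g ^ t)"
        unfolding z_def by (metis mult.commute mult.left_commute mult.right_neutral)
      also have "\<dots> \<longleftrightarrow> [s = t] (mod L)"
        using primitive_root_power_eq_iff[OF w] n_gt_2 power_cong_iff by simp
      finally show ?thesis using that by (simp add: cong_def)
    qed
    moreover have "w ^ (g ^ s * k) * cnj (w ^ (g ^ t * k)) = z ^ k" for k
      by (simp add: z_def power_mult_distrib power_mult)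
    ultimately show ?thesis using sum_powers_root_of_unity[of z n] by simp
  qed
  have "(\<Sum>k<n. A k * cnj (A k)) =
    (\<Sum>k<n. \<Sum>s<L. \<Sum>t<L. (-1) ^ (s + t) * (w ^ (g ^ s * k) * cnj (w ^ (g ^ t * k))))"
    unfolding quadratic_sum_def cnj_sum sum_product
    by (intro sum.cong refl) (simp add: power_add)
  also have "\<dots> = (\<Sum>s<L. \<Sum>k<n. \<Sum>t<L. (-1) ^ (s + t) * (w ^ (g ^ s * k) * cnj (w ^ (g ^ t * k))))"
    by (rule sum.swap)
  also have "\<dots> = (\<Sum>s<L. \<Sum>t<L. (-1) ^ (s + t) * (\<Sum>k<n. w ^ (g ^ s * k) * cnj (w ^ (g ^ t * k))))"
    unfolding sum_distrib_left by (intro sum.cong refl sum.swap)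
  also have "\<dots> = (\<Sum>s<L. \<Sum>t<L. if s = t then of_nat n else 0)"
    by (intro sum.cong refl, subst inner) (simp_all flip: mult_2)
  also have "\<dots> = of_nat (n * L)" by simp
  finally show ?thesis .
qed


lemma quadratic_sum_0: "A 0 = 0"
proof -
  have "(\<Sum>s<2 * j. (-1 :: complex) ^ s) = 0" for j by (induction j) auto
  thus ?thesis using even_L by (auto simp: quadratic_sum_def elim!: evenE)
qed

lemma quadratic_sum_unit:
  assumes "\<not> P dvd k"
  shows "A k = A 1 \<or> A k = - A 1"
proof -
  have "\<not> P dvd k mod n" using assms P_dvd_n by (simp add: dvd_mod_iff)
  hence "k mod n \<in> (\<lambda>s. g ^ s mod n) ` {..<L}"
    using bij_powers n_pos by (auto simp: bij_betw_def)
  then obtain t where "k mod n = g ^ t mod n" by auto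
  hence "A k = A (g ^ t * 1)" by (intro quadratic_sum_cong) (simp add: cong_def)
  thus ?thesis using quadratic_sum_g_power[of t 1] by (cases "even t") auto
qed

lemma quadratic_sum_parseval_norm: "(\<Sum>k<n. (norm (A k))\<^sup>2) = real (n * L)"
proof -
  have "complex_of_real (\<Sum>k<n. (norm (A k))\<^sup>2) = (\<Sum>k<n. A k * cnj (A k))"
    by (simp only: of_real_sum complex_norm_square)
  also have "\<dots> = complex_of_real (real (n * L))" using quadratic_sum_parseval by simp
  finally show ?thesis by (simp only: of_real_eq_iff)
qed

text \<open>At every \<open>k\<close> prime to \<open>P\<close> the sum is \<open>A 1\<close> up to
  sign, so Parseval's total \<open>P * (P - 1)\<close> splits evenly over the \<open>P - 1\<close>
  nonzero residues.\<close>

lemma norm_quadratic_sum_prime: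
  assumes "r = 0" "\<not> P dvd k"
  shows "(norm (A k))\<^sup>2 = real P"
proof -
  have nP: "n = P" and LP: "L = P - 1" using n assms L_eq by auto
  have unit: "(norm (A k))\<^sup>2 = (norm (A 1))\<^sup>2" if "\<not> P dvd k" for k
    using quadratic_sum_unit[OF that] by auto
  have "(norm (A 1))\<^sup>2 = real P"
  proof -
    have "real (P * (P - 1)) = (\<Sum>k<P. (norm (A k))\<^sup>2)"
      using quadratic_sum_parseval_norm nP LP by simp
    also have "\<dots> = (\<Sum>k\<in>{..<P}-{0}. (norm (A k))\<^sup>2)"
      using P_ge_3 by (subst sum.remove[of _ 0]) (auto simp: quadratic_sum_0)
    also have "\<dots> = (\<Sum>k\<in>{..<P}-{0}. (norm (A 1))\<^sup>2)"
      by (intro sum.cong refl unit) (auto dest: dvd_imp_le)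
    also have "\<dots> = real (P - 1) * (norm (A 1))\<^sup>2" using P_ge_3 by simp
    finally show ?thesis using P_ge_3 by (simp add: mult.commute)
  qed
  thus ?thesis using unit[OF assms(2)] by simp
qed

text \<open>Every nonzero residue modulo \<open>P\<close> is also a unit modulo \<open>n\<close>,
  hence a power of \<open>g\<close>, and the powers of \<open>g\<close> take at most
  \<open>ord P g\<close> values modulo \<open>P\<close>.\<close>

lemma ord_prime: "ord P g = totient P"
proof -
  have cop: "coprime P g" using coprime_g unfolding n by simp
  define d where "d = ord P g"
  have d0: "d > 0" using cop by (simp add: d_def)
  have "{1..<P} \<subseteq> (\<lambda>t. g ^ t mod P) ` {..<d}"
  proof
    fix u assume u: "u \<in> {1..<P}"
    have "P \<le> n" using P_dvd_n n_pos by (rule dvd_imp_le)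
    hence "u \<in> {u. u < n \<and> \<not> P dvd u}" using u by (auto dest: dvd_imp_le)
    then obtain t where t: "u = g ^ t mod n" using bij_powers unfolding bij_betw_def by blast
    have "[g ^ t = g ^ (t mod d)] (mod P)"
      using order_divides_expdiff[of P g t "t mod d"] cop by (simp add: d_def cong_def)
    moreover have "u = u mod P" using u by simp
    hence "u = g ^ t mod P" unfolding t using P_dvd_n by (simp add: mod_mod_cancel)
    ultimately have "u = g ^ (t mod d) mod P" by (simp add: cong_def)
    thus "u \<in> (\<lambda>t. g ^ t mod P) ` {..<d}" using d0 by auto
  qed
  hence "card {1..<P} \<le> card ((\<lambda>t. g ^ t mod P) ` {..<d})" by (intro card_mono) auto
  also have "\<dots> \<le> d" using card_image_le[of "{..<d}" "\<lambda>t. g ^ t mod P"] by simp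
  finally have "P - 1 \<le> d" by simp
  moreover have "d dvd P - 1" using order_divides_totient[OF cop] totient_prime[OF P(1)] by (simp add: d_def)
  hence "d \<le> P - 1" using P_ge_3 by (intro dvd_imp_le) auto
  ultimately show ?thesis using totient_prime[OF P(1)] by (simp add: d_def)
qed

text \<open>Here \<open>w ^ (P ^ r)\<close> is a primitive \<open>P\<close>-th root of unity and the
  summand has period \<open>P - 1\<close>, so the sum consists of \<open>P ^ r\<close> copies of a
  quadratic sum modulo \<open>P\<close>.\<close>

lemma norm_quadratic_sum_multiple:
  assumes "\<not> P dvd j"
  shows "(norm (A (P ^ r * j)))\<^sup>2 = real (P ^ (2 * r + 1))"
proof -
  have w': "primitive_root_of_unity P (w ^ (P ^ r))"
    using primitive_root_power[of "P ^ r" P w] w P_ge_3 n by (simp add: mult.commute)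
  interpret base: primitive_root_prime_power P 0 g P "w ^ (P ^ r)"
    using P w' ord_prime by unfold_locales auto
  define F where "F s = (-1 :: complex) ^ s * (w ^ (P ^ r)) ^ (g ^ s * j)" for s
  have per: "F (s + (P - 1)) = F s" for s
  proof -
    have "[g ^ (P - 1) = 1] (mod P)"
      using ord_divides[of g "P - 1" P] ord_prime totient_prime[OF P(1)] by simp
    hence "[g ^ s * j * g ^ (P - 1) = g ^ s * j * 1] (mod P)" by (rule cong_scalar_left)
    hence "(w ^ (P ^ r)) ^ (g ^ (s + (P - 1)) * j) = (w ^ (P ^ r)) ^ (g ^ s * j)"
      by (intro base.w_power_cong) (simp add: power_add mult_ac)
    moreover have "even (P - 1)" using P by simp
    ultimately show ?thesis by (simp add: F_def power_add)
  qed
  have "A (P ^ r * j) = (\<Sum>s<P ^ r * (P - 1). F s)"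
    unfolding quadratic_sum_def F_def L_eq power_mult[symmetric] by (simp add: mult_ac)
  also have "\<dots> = of_nat (P ^ r) * (\<Sum>s<P - 1. F s)"
    by (rule sum_lessThan_mult_periodic) (rule per)
  also have "(\<Sum>s<P - 1. F s) = quadratic_sum (totient P) g (w ^ (P ^ r)) j"
    unfolding quadratic_sum_def F_def using totient_prime[OF P(1)] by simp
  finally have "(norm (A (P ^ r * j)))\<^sup>2 =
      (real (P ^ r))\<^sup>2 * (norm (quadratic_sum (totient P) g (w ^ (P ^ r)) j))\<^sup>2"
    by (simp add: norm_mult norm_power power_mult_distrib)
  also have "\<dots> = (real (P ^ r))\<^sup>2 * P" using base.norm_quadratic_sum_prime[OF refl assms] by simp
  finally show ?thesis by (simp add: power_mult power_even_eq mult.commute)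
qed

text \<open>By Parseval, the values at the multiples of \<open>P ^ r\<close> already exhaust the square norm, so all
  others vanish.\<close>

lemma norm_quadratic_sum:
  "(norm (A k))\<^sup>2 = (if P ^ r dvd k \<and> \<not> n dvd k then real (P ^ (2 * r + 1)) else 0)"
proof -
  have 1: "(norm (A k))\<^sup>2 = real (P ^ (2 * r + 1))" if "P ^ r dvd k" "\<not> n dvd k" for k
    using that norm_quadratic_sum_multiple by (auto simp: n elim!: dvdE)
  define S where "S = (\<lambda>j. P ^ r * j) ` {1..<P}"
  have Sub: "S \<subseteq> {..<n}" using P_ge_3 by (auto simp: S_def n)
  have S: "P ^ r dvd k \<and> \<not> n dvd k" if "k \<in> S" for k
    using that P_ge_3 by (auto simp: S_def n dest: dvd_imp_le)
  have S': "k \<in> S" if "P ^ r dvd k" "\<not> n dvd k" "k < n" for k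
  proof -
    obtain j where j: "k = P ^ r * j" using \<open>P ^ r dvd k\<close> by auto
    have "j \<noteq> 0" using that j by (intro notI) simp
    moreover have "j < P" using that j P_ge_3 by (simp add: n)
    ultimately show ?thesis using j by (auto simp: S_def)
  qed
  have "card S = P - 1" unfolding S_def using P_ge_3 by (subst card_image) (auto simp: inj_on_def)
  moreover have "(\<Sum>k\<in>S. (norm (A k))\<^sup>2) = (\<Sum>k\<in>S. real (P ^ (2 * r + 1)))"
    using 1 S by (intro sum.cong) blast+
  ultimately have "(\<Sum>k\<in>S. (norm (A k))\<^sup>2) = real (P - 1) * real (P ^ (2 * r + 1))" by simp
  also have "\<dots> = real (n * L)" unfolding L_eq unfolding n by (simp add: power_add power_mult power2_eq_square mult_ac power_mult_distrib mult_2)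
  also have "\<dots> = (\<Sum>k<n. (norm (A k))\<^sup>2)" using quadratic_sum_parseval_norm by simp
  also have "\<dots> = (\<Sum>k\<in>{..<n}-S. (norm (A k))\<^sup>2) + (\<Sum>k\<in>S. (norm (A k))\<^sup>2)"
    using Sub by (simp add: sum.subset_diff)
  finally have "(\<Sum>k\<in>{..<n}-S. (norm (A k))\<^sup>2) = 0" by simp
  hence z: "(norm (A k))\<^sup>2 = 0" if "k \<in> {..<n} - S" for k
    using that by (subst (asm) sum_nonneg_eq_0_iff) auto
  have red: "A k = A (k mod n)" by (intro quadratic_sum_cong) (simp add: cong_def)
  have "P ^ r dvd n" by (simp add: n)
  hence d: "P ^ r dvd k mod n \<longleftrightarrow> P ^ r dvd k" "n dvd k mod n \<longleftrightarrow> n dvd k"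
    by (simp_all add: dvd_mod_iff)
  show ?thesis
  proof (cases "P ^ r dvd k \<and> \<not> n dvd k")
    case False
    hence "k mod n \<notin> S" using S d by blast
    thus ?thesis using z[of "k mod n"] n_pos red False by auto
  qed (use 1 in auto)
qed

lemma even_half_totient_iff: "even (L div 2) \<longleftrightarrow> [P = 1] (mod 4)"
proof -
  obtain j where j: "P = 2 * j + 1" using P by (auto elim!: oddE)
  have "L = 2 * (P ^ r * j)" unfolding L_eq j by simp
  hence "L div 2 = P ^ r * j" by simp
  hence "even (L div 2) \<longleftrightarrow> even j" using P by simp
  also have "\<dots> \<longleftrightarrow> [P = 1] (mod 4)" unfolding j by (auto simp: cong_def elim!: evenE oddE) presburger+
  finally show ?thesis .
qed

end

section \<open>Additive characters and strongly regular Cayley graphs\<close>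

lemma primitive_element_power_eq_1_iff:
  fixes \<gamma> :: "'a :: {finite, field}"
  assumes "primitive_element \<gamma>"
  shows "\<gamma> ^ k = 1 \<longleftrightarrow> CARD('a) - 1 dvd k"
proof -
  let ?n = "CARD('a) - 1"
  have g0: "\<gamma> \<noteq> 0" and gen: "\<And>x. x \<noteq> 0 \<Longrightarrow> \<exists>k. x = \<gamma> ^ k"
    using assms by (auto simp: primitive_element_def)
  have card: "card (UNIV - {0 :: 'a}) = ?n" by (simp add: card_Diff_singleton)
  have "1 \<in> UNIV - {0 :: 'a}" by simp
  hence npos: "?n > 0" using card by (metis card_gt_0_iff empty_iff finite)
  have *: "?n \<le> d" if d: "\<gamma> ^ d = 1" "d > 0" for d
  proof -
    have "UNIV - {0} \<subseteq> (\<lambda>k. \<gamma> ^ k) ` {..<d}"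
    proof
      fix x :: 'a assume "x \<in> UNIV - {0}"
      then obtain k where k: "x = \<gamma> ^ k" using gen by auto
      have "\<gamma> ^ k = \<gamma> ^ (d * (k div d) + k mod d)" by simp
      also have "\<dots> = \<gamma> ^ (k mod d)" unfolding power_add power_mult d by simp
      finally show "x \<in> (\<lambda>k. \<gamma> ^ k) ` {..<d}" using k d by auto
    qed
    hence "card (UNIV - {0 :: 'a}) \<le> card ((\<lambda>k. \<gamma> ^ k) ` {..<d})" by (intro card_mono) auto
    also have "\<dots> \<le> d" using card_image_le[of "{..<d}" "\<lambda>k. \<gamma> ^ k"] by simp
    finally show ?thesis using card by simp
  qed
  have one: "\<gamma> ^ ?n = 1"
  proof -
    \<comment> \<open>Pigeonhole: there is one more exponent than there are nonzero elements. The
      period found this way is at most \<open>?n\<close>, and by the bound above at least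
      \<open>?n\<close>.\<close>
    have "\<not> inj_on (\<lambda>k. \<gamma> ^ k) {..?n}"
    proof
      assume "inj_on (\<lambda>k. \<gamma> ^ k) {..?n}"
      hence "card ((\<lambda>k. \<gamma> ^ k) ` {..?n}) = Suc ?n" by (simp add: card_image)
      moreover have "card ((\<lambda>k. \<gamma> ^ k) ` {..?n}) \<le> card (UNIV - {0 :: 'a})"
        using g0 by (intro card_mono) auto
      ultimately show False using card by simp
    qed
    then obtain i j where ij: "i < j" "j \<le> ?n" "\<gamma> ^ i = \<gamma> ^ j"
      unfolding inj_on_def by (metis atMost_iff linorder_neqE_nat)
    have "\<gamma> ^ j = \<gamma> ^ i * \<gamma> ^ (j - i)" using ij(1) by (simp flip: power_add)
    hence "\<gamma> ^ (j - i) = 1" using ij g0 by simp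
    moreover from this have "?n \<le> j - i" using *[of "j - i"] ij by simp
    hence "j - i = ?n" using ij by simp
    ultimately show ?thesis by simp
  qed
  have "\<gamma> ^ k = \<gamma> ^ (?n * (k div ?n) + k mod ?n)" by (simp only: mult_div_mod_eq)
  also have "\<dots> = \<gamma> ^ (k mod ?n)" unfolding power_add power_mult one by simp
  finally have "\<gamma> ^ k = 1 \<longleftrightarrow> \<gamma> ^ (k mod ?n) = 1" by simp
  also have "\<dots> \<longleftrightarrow> k mod ?n = 0"
  proof
    assume "\<gamma> ^ (k mod ?n) = 1"
    thus "k mod ?n = 0" using *[of "k mod ?n"] npos mod_less_divisor[OF npos, of k] by (metis neq0_conv not_le)
  qed (metis power_0)
  finally show ?thesis by (simp add: dvd_eq_mod_eq_0)
qed

lemma primitive_element_power_eq_iff: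
  fixes \<gamma> :: "'a :: {finite, field}"
  assumes "primitive_element \<gamma>"
  shows "\<gamma> ^ j = \<gamma> ^ k \<longleftrightarrow> [j = k] (mod (CARD('a) - 1))"
proof (induction j k rule: linorder_wlog)
  case (le j k)
  have "\<gamma> ^ k = \<gamma> ^ j * \<gamma> ^ (k - j)" using le by (simp flip: power_add)
  hence "\<gamma> ^ j = \<gamma> ^ k \<longleftrightarrow> \<gamma> ^ (k - j) = 1" using assms by (auto simp: primitive_element_def)
  also have "\<dots> \<longleftrightarrow> CARD('a) - 1 dvd k - j" using primitive_element_power_eq_1_iff[OF assms] .
  also have "\<dots> \<longleftrightarrow> [j = k] (mod (CARD('a) - 1))" using le by (metis cong_altdef_nat cong_sym_eq)
  finally show ?case .
next
  case (sym j k)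
  then show ?case by (metis cong_sym_eq)
qed

lemma primitive_element_power_card:
  fixes \<gamma> x :: "'a :: {finite, field}"
  assumes "primitive_element \<gamma>"
  shows "x ^ CARD('a) = x"
proof (cases "x = 0")
  case False
  then obtain k where k: "x = \<gamma> ^ k" using assms by (auto simp: primitive_element_def)
  have "[k * (CARD('a) - 1) + k = 0 + k] (mod (CARD('a) - 1))" by (simp add: cong_def)
  moreover have "k * (CARD('a) - 1) + k = k * CARD('a)"
    by (metis (no_types) add.commute Suc_diff_1 mult_Suc_right finite_UNIV_card_ge_0 finite)
  ultimately have "\<gamma> ^ (k * CARD('a)) = \<gamma> ^ k"
    using primitive_element_power_eq_iff[OF assms] by simp
  thus ?thesis using k by (simp add: power_mult)
qed (simp add: power_0_left)

text \<open>The Fourier analysis below rests on these properties alone. The trace formula serves to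
  establish them, together with Frobenius invariance.\<close>

locale nontrivial_additive_character =
  fixes \<psi> :: "'a :: {finite, field} \<Rightarrow> complex"
  assumes psi_0: "\<psi> 0 = 1"
    and psi_add: "\<psi> (x + y) = \<psi> x * \<psi> y"
    and psi_nontrivial: "\<exists>x. \<psi> x \<noteq> 1"
begin

lemma psi_of_nat: "\<psi> (of_nat k * x) = \<psi> x ^ k"
  by (induction k) (simp_all add: psi_0 psi_add distrib_right)

lemma norm_psi: "norm (\<psi> x) = 1"
proof -
  have "of_nat CARD('a) = (0 :: 'a)" using of_nat_eq_0_iff_char_dvd CHAR_dvd_CARD by blast
  hence "\<psi> x ^ CARD('a) = 1" using psi_of_nat[of "CARD('a)" x] by (simp add: psi_0)
  thus ?thesis by (rule root_of_unity_norm) (simp add: card_gt_0_iff)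
qed

lemma cnj_psi: "cnj (\<psi> x) = \<psi> (- x)"
proof -
  have "\<psi> x * cnj (\<psi> x) = 1" using norm_psi by (rule norm_1_mult_cnj)
  moreover have "\<psi> (- x) * \<psi> x = 1" using psi_add[of "- x" x] by (simp add: psi_0)
  ultimately show ?thesis by (metis mult.assoc mult.left_neutral mult.right_neutral)
qed

lemma sum_psi: "(\<Sum>x\<in>UNIV. \<psi> x) = 0"
proof -
  obtain t where t: "\<psi> t \<noteq> 1" using psi_nontrivial by auto
  have "(\<Sum>x\<in>UNIV. \<psi> x) = (\<Sum>x\<in>UNIV. \<psi> (t + x))"
    by (rule sum.reindex_bij_witness[of _ "\<lambda>x. t + x" "\<lambda>x. x - t"]) auto
  also have "\<dots> = \<psi> t * (\<Sum>x\<in>UNIV. \<psi> x)" by (simp add: psi_add sum_distrib_left)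
  finally show ?thesis using t by simp
qed

lemma sum_psi_mult: "(\<Sum>x\<in>UNIV. \<psi> (y * x)) = (if y = 0 then of_nat CARD('a) else 0)"
proof (cases "y = 0")
  case False
  hence "(\<Sum>x\<in>UNIV. \<psi> (y * x)) = (\<Sum>x\<in>UNIV. \<psi> x)"
    by (intro sum.reindex_bij_witness[of _ "\<lambda>x. x / y" "\<lambda>x. y * x"]) auto
  thus ?thesis using False sum_psi by simp
qed (simp add: psi_0)

lemma sum_psi_nonzero: "(\<Sum>x\<in>UNIV - {0}. \<psi> x) = -1"
  using sum_psi by (subst (asm) sum.remove[of _ 0]) (auto simp: psi_0 add_eq_0_iff)

text \<open>For symmetric \<open>D\<close>, this is the eigenvalue of the Cayley graph on the
  eigenvector \<open>x \<mapsto> \<psi> (y * x)\<close>.\<close>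

definition char_sum :: "'a set \<Rightarrow> 'a \<Rightarrow> complex" where
  "char_sum D y = (\<Sum>x\<in>D. \<psi> (y * x))"

definition rep_count :: "'a set \<Rightarrow> 'a \<Rightarrow> nat" where
  "rep_count D z = card {d \<in> D. z - d \<in> D}"

text \<open>A convolution identity: squaring the Fourier transform of the indicator of
  \<open>D\<close> gives the transform of its self-convolution \<open>rep_count D\<close>.\<close>

lemma char_sum_power2: "(char_sum D y)\<^sup>2 = (\<Sum>z\<in>UNIV. of_nat (rep_count D z) * \<psi> (y * z))"
proof -
  have "(char_sum D y)\<^sup>2 = (\<Sum>d\<in>D. \<Sum>e\<in>D. \<psi> (y * (d + e)))"
    by (simp add: char_sum_def power2_eq_square sum_product psi_add distrib_left)
  also have "\<dots> = (\<Sum>d\<in>D. \<Sum>z\<in>UNIV. if z - d \<in> D then \<psi> (y * z) else 0)"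
  proof (rule sum.cong[OF refl])
    fix d assume "d \<in> D"
    have "(\<Sum>e\<in>D. \<psi> (y * (d + e))) = (\<Sum>z | z - d \<in> D. \<psi> (y * z))"
      by (rule sum.reindex_bij_witness[of _ "\<lambda>z. z - d" "\<lambda>e. d + e"]) auto
    thus "(\<Sum>e\<in>D. \<psi> (y * (d + e))) = (\<Sum>z\<in>UNIV. if z - d \<in> D then \<psi> (y * z) else 0)"
      by (simp add: sum.If_cases)
  qed
  also have "\<dots> = (\<Sum>z\<in>UNIV. \<Sum>d\<in>D. if z - d \<in> D then \<psi> (y * z) else 0)" by (rule sum.swap)
  also have "\<dots> = (\<Sum>z\<in>UNIV. of_nat (rep_count D z) * \<psi> (y * z))"
    by (intro sum.cong refl) (simp add: sum.If_cases rep_count_def Int_def)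
  finally show ?thesis .
qed

lemma fourier_inversion:
  "(\<Sum>y\<in>UNIV. (\<Sum>z'\<in>UNIV. F z' * \<psi> (y * z')) * \<psi> (- (y * z))) = of_nat CARD('a) * F z"
proof -
  have "(\<Sum>y\<in>UNIV. (\<Sum>z'\<in>UNIV. F z' * \<psi> (y * z')) * \<psi> (- (y * z))) =
      (\<Sum>y\<in>UNIV. \<Sum>z'\<in>UNIV. F z' * \<psi> ((z' - z) * y))"
  proof -
    have "\<psi> (y * z') * \<psi> (- (y * z)) = \<psi> ((z' - z) * y)" for y z'
      by (simp add: psi_add[symmetric] algebra_simps)
    thus ?thesis by (simp add: sum_distrib_right mult.assoc)
  qed
  also have "\<dots> = (\<Sum>z'\<in>UNIV. F z' * (\<Sum>y\<in>UNIV. \<psi> ((z' - z) * y)))"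
    unfolding sum_distrib_left by (rule sum.swap)
  also have "\<dots> = (\<Sum>z'\<in>UNIV. if z' = z then of_nat CARD('a) * F z else 0)"
    unfolding sum_psi_mult by (intro sum.cong) auto
  finally show ?thesis by simp
qed

section \<open>Strong regularity in terms of character sums\<close>

context
  fixes D :: "'a set"
  assumes D_sym: "\<And>x. x \<in> D \<Longrightarrow> - x \<in> D" and D_0: "0 \<notin> D"
begin

lemma common_neighbours: "card {z \<in> UNIV. cayley_adj D x z \<and> cayley_adj D y z} = rep_count D (x - y)"
proof -
  have *: "u \<in> D \<longleftrightarrow> - u \<in> D" for u using D_sym[of u] D_sym[of "- u"] by auto
  have **: "y - (x - d) \<in> D \<longleftrightarrow> x - y - d \<in> D" for d
    using *[of "x - y - d"] by (simp add: algebra_simps)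
  have "bij_betw (\<lambda>d. x - d) {d \<in> D. x - y - d \<in> D} {z \<in> UNIV. cayley_adj D x z \<and> cayley_adj D y z}"
  proof (rule bij_betw_byWitness[of _ "\<lambda>z. x - z"])
    show "(\<lambda>d. x - d) ` {d \<in> D. x - y - d \<in> D} \<subseteq> {z \<in> UNIV. cayley_adj D x z \<and> cayley_adj D y z}"
      using ** by (simp add: cayley_adj_def image_subset_iff)
    have "y - z \<in> D \<longleftrightarrow> x - y - (x - z) \<in> D" for z using **[of "x - z"] by simp
    thus "(\<lambda>z. x - z) ` {z \<in> UNIV. cayley_adj D x z \<and> cayley_adj D y z} \<subseteq> {d \<in> D. x - y - d \<in> D}"
      by (simp add: cayley_adj_def image_subset_iff)
  qed simp_all
  thus ?thesis unfolding rep_count_def by (simp add: bij_betw_same_card)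
qed

lemma rep_count_0: "rep_count D 0 = card D"
  unfolding rep_count_def using D_sym by (intro arg_cong[where f=card]) auto

text \<open>The count is constant on \<open>D\<close>, on the nonzero complement and at 0, hence a
  combination of the all-one function, the indicator of \<open>D\<close> and the point mass at 0.
  For \<open>y \<noteq> 0\<close> their transforms are 0, \<open>char_sum D y\<close> and 1.\<close>

lemma strongly_regular_imp_quadratic:
  assumes "strongly_regular UNIV (cayley_adj D)"
  obtains u v where "\<And>y. y \<noteq> 0 \<Longrightarrow> (char_sum D y)\<^sup>2 = u * char_sum D y + v"
proof -
  obtain l m where *:
    "\<And>x y. cayley_adj D x y \<Longrightarrow> card {z \<in> UNIV. cayley_adj D x z \<and> cayley_adj D y z} = l"
    "\<And>x y. x \<noteq> y \<Longrightarrow> \<not> cayley_adj D x y \<Longrightarrow> card {z \<in> UNIV. cayley_adj D x z \<and> cayley_adj D y z} = m"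
    using assms unfolding strongly_regular_def strongly_regular_params_def by blast
  have l: "rep_count D z = l" if "z \<in> D" for z
    using *(1)[of z 0] that unfolding common_neighbours by (simp add: cayley_adj_def)
  have m: "rep_count D z = m" if "z \<notin> D" "z \<noteq> 0" for z
    using *(2)[of z 0] that unfolding common_neighbours by (simp add: cayley_adj_def)
  have c: "(of_nat (rep_count D z) :: complex) = of_nat m + (if z \<in> D then of_nat l - of_nat m else 0)
      + (if z = 0 then of_nat (card D) - of_nat m else 0)" for z
    using l m rep_count_0 D_0 by auto
  have "(char_sum D y)\<^sup>2 = (of_nat l - of_nat m) * char_sum D y + (of_nat (card D) - of_nat m)"
    if y: "y \<noteq> 0" for y
  proof -
    have "(char_sum D y)\<^sup>2 = of_nat m * (\<Sum>z\<in>UNIV. \<psi> (y * z))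
       + (\<Sum>z\<in>UNIV. (if z \<in> D then of_nat l - of_nat m else 0) * \<psi> (y * z))
       + (\<Sum>z\<in>UNIV. (if z = 0 then of_nat (card D) - of_nat m else 0) * \<psi> (y * z))"
      unfolding char_sum_power2 c distrib_right sum.distrib sum_distrib_left ..
    also have "(\<Sum>z\<in>UNIV. (if z = 0 then of_nat (card D) - of_nat m else 0) * \<psi> (y * z))
        = of_nat (card D) - of_nat m"
      by (subst sum.remove[of _ 0]) (auto simp: psi_0)
    also have "(\<Sum>z\<in>UNIV. (if z \<in> D then of_nat l - of_nat m else 0) * \<psi> (y * z))
       = (of_nat l - of_nat m) * char_sum D y"
      unfolding char_sum_def sum_distrib_left
      by (rule sum.mono_neutral_cong_right) auto
    finally show ?thesis using y sum_psi_mult by simp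
  qed
  thus ?thesis using that by blast
qed

text \<open>Fourier inversion recovers the counts from the squares, so a quadratic relation forces
  them, away from 0, to depend only on membership in \<open>D\<close>. The elements
  \<open>d1\<close> and \<open>d2\<close> witness that the graph is neither edgeless nor
  complete.\<close>

lemma quadratic_imp_strongly_regular:
  assumes quad: "\<And>y. y \<noteq> 0 \<Longrightarrow> (char_sum D y)\<^sup>2 = u * char_sum D y + v"
    and D1: "d1 \<in> D" and D2: "d2 \<notin> D" "d2 \<noteq> 0"
  shows "strongly_regular UNIV (cayley_adj D)"
proof -
  \<comment> \<open>The relation is not assumed at \<open>y = 0\<close>. The defect \<open>E\<close>
    there transforms to a constant and so does not disturb the constancy of the counts.\<close>
  define E where "E = (char_sum D 0)\<^sup>2 - u * char_sum D 0 - v"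
  have S: "(char_sum D y)\<^sup>2 = u * char_sum D y + v + (if y = 0 then E else 0)" for y
    using quad[of y] by (auto simp: E_def)
  have cs: "char_sum D y = (\<Sum>z\<in>UNIV. (if z \<in> D then 1 else 0) * \<psi> (y * z))" for y
    unfolding char_sum_def by (rule sum.mono_neutral_cong_left) auto
  have n: "of_nat CARD('a) * of_nat (rep_count D z) =
      u * (of_nat CARD('a) * (if z \<in> D then 1 else 0)) + v * (if z = 0 then of_nat CARD('a) else 0) + E" for z
  proof -
    have "of_nat CARD('a) * of_nat (rep_count D z) = (\<Sum>y\<in>UNIV. (char_sum D y)\<^sup>2 * \<psi> (- (y * z)))"
      unfolding char_sum_power2 by (rule fourier_inversion[symmetric])
    also have "\<dots> = u * (\<Sum>y\<in>UNIV. char_sum D y * \<psi> (- (y * z))) + v * (\<Sum>y\<in>UNIV. \<psi> (- (y * z)))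
        + (\<Sum>y\<in>UNIV. (if y = 0 then E else 0) * \<psi> (- (y * z)))"
      unfolding S distrib_right sum.distrib sum_distrib_left by (simp add: mult.assoc)
    also have "(\<Sum>y\<in>UNIV. (if y = 0 then E else 0) * \<psi> (- (y * z))) = E"
      by (subst sum.remove[of _ 0]) (auto simp: psi_0)
    also have "(\<Sum>y\<in>UNIV. \<psi> (- (y * z))) = (if z = 0 then of_nat CARD('a) else 0)"
      using sum_psi_mult[of "- z"] by (simp add: mult.commute)
    also have "(\<Sum>y\<in>UNIV. char_sum D y * \<psi> (- (y * z))) = of_nat CARD('a) * (if z \<in> D then 1 else 0)"
      unfolding cs by (rule fourier_inversion)
    finally show ?thesis .
  qed
  have q: "(of_nat CARD('a) :: complex) \<noteq> 0" by simp
  have l: "rep_count D z = rep_count D d1" if "z \<in> D" for z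
  proof -
    have "z \<noteq> 0" "d1 \<noteq> 0" using that D1 D_0 by auto
    hence "(of_nat CARD('a) :: complex) * of_nat (rep_count D z) = of_nat CARD('a) * of_nat (rep_count D d1)"
      unfolding n using that D1 by simp
    thus ?thesis using q by simp
  qed
  have m: "rep_count D z = rep_count D d2" if "z \<notin> D" "z \<noteq> 0" for z
  proof -
    have "(of_nat CARD('a) :: complex) * of_nat (rep_count D z) = of_nat CARD('a) * of_nat (rep_count D d2)"
      unfolding n using that D2 by simp
    thus ?thesis using q by simp
  qed
  have "strongly_regular_params UNIV (cayley_adj D) CARD('a) (card D) (rep_count D d1) (rep_count D d2)"
    unfolding strongly_regular_params_def common_neighbours
  proof (intro conjI ballI impI)
    show "simple_graph UNIV (cayley_adj D)"
      unfolding simple_graph_def cayley_adj_def using D_0 D_sym by fastforce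
    show "\<exists>x\<in>UNIV. \<exists>y\<in>UNIV. x \<noteq> y \<and> \<not> cayley_adj D x y"
      by (rule bexI[of _ d2], rule bexI[of _ 0]) (use D2 in \<open>auto simp: cayley_adj_def\<close>)
    show "\<exists>x\<in>UNIV. \<exists>y\<in>UNIV. cayley_adj D x y"
      by (rule bexI[of _ d1], rule bexI[of _ 0]) (use D1 in \<open>auto simp: cayley_adj_def\<close>)
    show "card {z \<in> UNIV. cayley_adj D x z} = card D" for x
      using common_neighbours[of x x] rep_count_0 by simp
  qed (use l m in \<open>auto simp: cayley_adj_def\<close>)
  thus ?thesis unfolding strongly_regular_def by blast
qed

end

end

section \<open>The trace character of a finite field\<close>

lemma card_power_CHAR:
  assumes "CARD('a :: {finite, field}) = p ^ f" "prime p"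
  shows "CHAR('a) = p"
proof -
  have pr: "prime CHAR('a)"
    using prime_CHAR_semidom[where ?'a='a] finite_imp_CHAR_pos[where ?'a='a] by simp
  moreover have "CHAR('a) dvd p ^ f" using CHAR_dvd_CARD[where ?'a='a] assms by simp
  ultimately show ?thesis using assms by (metis prime_dvd_power primes_dvd_imp_eq)
qed

context
  fixes p f :: nat
  assumes q: "CARD('a :: {finite, field}) = p ^ f" and p: "prime p"
begin

private lemma char: "CHAR('a) = p" using card_power_CHAR[OF q p] .

private lemma prime_char: "prime CHAR('a)" using char p by simp

lemma f_pos: "f > 0"
proof (rule ccontr)
  assume "\<not> f > 0"
  hence "CARD('a) = 1" using q by simp
  hence "(0 :: 'a) = 1" by (metis UNIV_I card_1_singletonE singletonD)
  thus False by simp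
qed

lemma absolute_trace_add:
  "absolute_trace p f (x + y) = absolute_trace p f x + absolute_trace p f (y :: 'a)"
  unfolding absolute_trace_def sum.distrib[symmetric]
  by (intro sum.cong refl freshmans_dream' prime_char) (simp add: char)

lemma frobenius_absolute_trace:
  assumes "(x :: 'a) ^ (p ^ f) = x"
  shows "absolute_trace p f x ^ p = absolute_trace p f x"
    and "absolute_trace p f (x ^ p) = absolute_trace p f x"
proof -
  have "(\<Sum>i<f. x ^ p ^ Suc i) + x = (\<Sum>i<f. x ^ p ^ i) + x"
    using sum.lessThan_Suc_shift[of "\<lambda>i. x ^ p ^ i" f] assms by (simp add: add.commute)
  hence s: "(\<Sum>i<f. x ^ p ^ Suc i) = absolute_trace p f x" by (simp add: absolute_trace_def)
  have "absolute_trace p f x ^ p = (\<Sum>i<f. (x ^ p ^ i) ^ p)"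
    unfolding absolute_trace_def by (rule freshmans_dream_sum) (simp_all add: char p)
  also have "\<dots> = (\<Sum>i<f. x ^ p ^ Suc i)" by (simp add: power_mult[symmetric] mult.commute)
  finally show "absolute_trace p f x ^ p = absolute_trace p f x" using s by simp
  have "absolute_trace p f (x ^ p) = (\<Sum>i<f. x ^ p ^ Suc i)"
    unfolding absolute_trace_def by (simp add: power_mult)
  thus "absolute_trace p f (x ^ p) = absolute_trace p f x" using s by simp
qed

text \<open>The polynomial \<open>X^p - X\<close> has at most \<open>p\<close> roots and the prime
  field supplies \<open>p\<close> of them. Unique existence is what gives the \<open>THE\<close> in
  \<open>additive_character\<close> its meaning.\<close>

lemma frobenius_fixed_imp_of_nat:
  assumes "(t :: 'a) ^ p = t"
  shows "\<exists>!k. k < p \<and> of_nat k = t"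
proof -
  have inj: "inj_on (of_nat :: nat \<Rightarrow> 'a) {..<p}"
    by (auto simp: inj_on_def of_nat_eq_iff_cong_CHAR char cong_def)
  have frob: "(of_nat k :: 'a) ^ p = of_nat k" for k
  proof (induction k)
    case (Suc k)
    have "(of_nat k + 1 :: 'a) ^ p = of_nat k ^ p + 1 ^ p"
      by (rule freshmans_dream) (simp_all add: char p)
    thus ?case using Suc by (simp add: add.commute)
  qed (use prime_gt_0_nat[OF p] in simp)
  define P :: "'a poly" where "P = Polynomial.monom 1 p - Polynomial.monom 1 1"
  have p1: "p > 1" using prime_gt_1_nat[OF p] .
  have "Polynomial.coeff P p = 1" using p1 by (simp add: P_def)
  hence P0: "P \<noteq> 0" by auto
  have "Polynomial.degree P \<le> p" using p1 unfolding P_def by (intro degree_diff_le degree_monom_le[THEN order_trans]) auto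
  hence "card {x. poly P x = 0} \<le> p" using card_poly_roots_bound[OF P0] by simp
  hence "card {x :: 'a. x ^ p = x} \<le> p" by (simp add: P_def poly_monom)
  moreover have "of_nat ` {..<p} \<subseteq> {x :: 'a. x ^ p = x}" using frob by auto
  moreover have "card ((of_nat :: nat \<Rightarrow> 'a) ` {..<p}) = p" using inj by (simp add: card_image)
  ultimately have "of_nat ` {..<p} = {x :: 'a. x ^ p = x}" by (intro card_seteq) auto
  hence "t \<in> of_nat ` {..<p}" using assms by simp
  then obtain k where "k < p" "of_nat k = t" by auto
  thus ?thesis using inj by (auto simp: inj_on_def)
qed

context
  fixes \<xi> :: complex
  assumes xi: "primitive_root_of_unity p \<xi>"
    and power_card: "\<And>x :: 'a. x ^ (p ^ f) = x"
begin

lemma additive_character_exponent: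
  obtains k where "of_nat k = absolute_trace p f (x :: 'a)" "additive_character p f \<xi> x = \<xi> ^ k"
proof -
  have "\<exists>!k. k < p \<and> of_nat k = absolute_trace p f x"
    by (intro frobenius_fixed_imp_of_nat frobenius_absolute_trace power_card)
  from theI'[OF this] show ?thesis using that by (auto simp: additive_character_def)
qed

lemma additive_character_frobenius:
  "additive_character p f \<xi> ((x :: 'a) ^ p) = additive_character p f \<xi> x"
  unfolding additive_character_def frobenius_absolute_trace(2)[OF power_card] ..

text \<open>Since the characteristic is \<open>p\<close>, an exponent of \<open>\<xi>\<close>
  matters only through its image in the field, so additivity of the trace becomes multiplicativity.
  Nontriviality holds because the trace is a nonzero polynomial of degree below the field
  size.\<close>

lemma nontrivial_additive_character:
  "nontrivial_additive_character (additive_character p f \<xi> :: 'a \<Rightarrow> complex)"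
proof
  let ?psi = "additive_character p f \<xi> :: 'a \<Rightarrow> complex"
  have p0: "p > 0" using p prime_gt_0_nat by simp
  have eq: "\<xi> ^ j = \<xi> ^ k \<longleftrightarrow> (of_nat j :: 'a) = of_nat k" for j k
    using primitive_root_power_eq_iff[OF xi p0] by (simp add: of_nat_eq_iff_cong_CHAR char)
  show "?psi (x + y) = ?psi x * ?psi y" for x y
  proof -
    obtain j where j: "of_nat j = absolute_trace p f x" "?psi x = \<xi> ^ j"
      by (rule additive_character_exponent)
    obtain k where k: "of_nat k = absolute_trace p f y" "?psi y = \<xi> ^ k"
      by (rule additive_character_exponent)
    obtain l where l: "of_nat l = absolute_trace p f (x + y)" "?psi (x + y) = \<xi> ^ l"
      by (rule additive_character_exponent)
    have "(of_nat l :: 'a) = of_nat (j + k)" using j k l absolute_trace_add[of x y] by simp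
    hence "\<xi> ^ l = \<xi> ^ (j + k)" using eq by blast
    thus ?thesis unfolding j k l power_add .
  qed
  have psi1: "?psi x = 1 \<longleftrightarrow> absolute_trace p f x = 0" for x
  proof -
    obtain j where j: "of_nat j = absolute_trace p f x" "?psi x = \<xi> ^ j"
      by (rule additive_character_exponent)
    show ?thesis using eq[of j 0] j by simp
  qed
  show "?psi 0 = 1" unfolding psi1 absolute_trace_def using p0 by (simp add: power_0_left)
  define P :: "'a poly" where "P = (\<Sum>i<f. Polynomial.monom 1 (p ^ i))"
  have p1: "p > 1" using prime_gt_1_nat[OF p] .
  have "Polynomial.coeff P (p ^ (f - 1)) = (\<Sum>i<f. if i = f - 1 then 1 else 0)"
    unfolding P_def coeff_sum using p1 by (intro sum.cong) auto
  also have "\<dots> = 1" using f_pos by simp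
  finally have P0: "P \<noteq> 0" by auto
  have "Polynomial.degree P \<le> p ^ (f - 1)"
    unfolding P_def using p1 by (intro degree_sum_le) (auto simp: degree_monom_eq)
  also have "\<dots> < p ^ f" using p1 f_pos by simp
  finally have "card {x. poly P x = 0} < CARD('a)" using card_poly_roots_bound[OF P0] q by simp
  hence "{x. poly P x = 0} \<noteq> UNIV" by auto
  then obtain x where "poly P x \<noteq> 0" by auto
  hence "absolute_trace p f x \<noteq> 0" by (simp add: P_def poly_sum poly_monom absolute_trace_def)
  thus "\<exists>x. ?psi x \<noteq> 1" using psi1 by auto
qed

end

end

section \<open>Gauss sums of index two\<close>

context nontrivial_additive_character
begin

definition gsum :: "('a \<Rightarrow> complex) \<Rightarrow> complex" where
  "gsum chi = (\<Sum>x\<in>UNIV - {0}. chi x * \<psi> x)"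

lemma gsum_cong: "(\<And>x. x \<noteq> 0 \<Longrightarrow> chi x = chi' x) \<Longrightarrow> gsum chi = gsum chi'"
  unfolding gsum_def by (intro sum.cong) auto

context
  fixes chi :: "'a \<Rightarrow> complex"
  assumes chi: "multiplicative_character chi"
begin

lemma chi_mult: "x \<noteq> 0 \<Longrightarrow> y \<noteq> 0 \<Longrightarrow> chi (x * y) = chi x * chi y"
  using chi by (auto simp: multiplicative_character_def)

lemma chi_nonzero: "x \<noteq> 0 \<Longrightarrow> chi x \<noteq> 0"
  using chi by (auto simp: multiplicative_character_def)

lemma chi_1: "chi 1 = 1"
  using chi_mult[of 1 1] chi_nonzero[of 1] by simp

lemma chi_power: "x \<noteq> 0 \<Longrightarrow> chi (x ^ k) = chi x ^ k"
  by (induction k) (simp_all add: chi_1 chi_mult)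

lemma cnj_gsum:
  assumes "chi (- 1) = 1"
  shows "cnj (gsum chi) = gsum (\<lambda>x. cnj (chi x))"
proof -
  have "chi (- x) = chi x" if "x \<noteq> 0" for x
    using chi_mult[of "- 1" x] assms that by simp
  thus ?thesis unfolding gsum_def cnj_sum complex_cnj_mult cnj_psi
    by (intro sum.reindex_bij_witness[of _ uminus uminus]) auto
qed

text \<open>The Frobenius map permutes the nonzero elements, with inverse
  \<open>x \<mapsto> x ^ (p ^ (f - 1))\<close>, and \<open>\<psi>\<close> is invariant under
  it.\<close>

lemma gsum_frobenius:
  assumes "\<And>x :: 'a. x ^ (p ^ f) = x" "f > 0" "p > 0" "\<And>x. \<psi> (x ^ p) = \<psi> x"
  shows "gsum (\<lambda>x. chi x ^ p) = gsum chi"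
proof -
  obtain e where "f = Suc e" using assms(2) by (cases f) auto
  hence *: "x ^ (p * p ^ e) = x" for x :: 'a using assms(1) by simp
  show ?thesis unfolding gsum_def
    by (rule sum.reindex_bij_witness[of _ "\<lambda>x. x ^ (p ^ e)" "\<lambda>x. x ^ p"])
      (use assms(3,4) in \<open>auto simp: power_mult[symmetric] * mult.commute[of _ p] chi_power\<close>)
qed

lemma sum_chi:
  assumes "t \<noteq> 0" "chi t \<noteq> 1"
  shows "(\<Sum>x\<in>UNIV - {0}. chi x) = 0"
proof -
  have "(\<Sum>x\<in>UNIV - {0}. chi x) = (\<Sum>x\<in>UNIV - {0}. chi (t * x))"
    by (rule sum.reindex_bij_witness[of _ "\<lambda>x. t * x" "\<lambda>x. x / t"]) (use assms in auto)
  also have "\<dots> = chi t * (\<Sum>x\<in>UNIV - {0}. chi x)"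
    unfolding sum_distrib_left using assms by (intro sum.cong) (auto simp: chi_mult)
  finally show ?thesis using assms by simp
qed

text \<open>After replacing \<open>x\<close> by \<open>x * y\<close> the inner sum over
  \<open>y\<close> is a complete additive sum without its zero term, so only \<open>x = 1\<close>
  contributes, apart from a sum of \<open>chi\<close> that vanishes by nontriviality.\<close>

lemma gsum_mult_cnj:
  assumes norm: "\<And>x. x \<noteq> 0 \<Longrightarrow> norm (chi x) = 1" and t: "t \<noteq> 0" "chi t \<noteq> 1"
  shows "gsum chi * cnj (gsum chi) = of_nat CARD('a)"
proof -
  let ?U = "UNIV - {0 :: 'a}"
  have "gsum chi * cnj (gsum chi) = (\<Sum>y\<in>?U. \<Sum>x\<in>?U. chi x * cnj (chi y) * \<psi> (x - y))"
    unfolding gsum_def cnj_sum sum_product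
  proof (subst sum.swap, intro sum.cong refl)
    show "chi x * \<psi> x * cnj (chi y * \<psi> y) = chi x * cnj (chi y) * \<psi> (x - y)" for x y
      using psi_add[of x "- y"] by (simp add: cnj_psi)
  qed
  also have "\<dots> = (\<Sum>y\<in>?U. \<Sum>x\<in>?U. chi x * \<psi> ((x - 1) * y))"
  proof (rule sum.cong[OF refl])
    fix y :: 'a assume y: "y \<in> ?U"
    show "(\<Sum>x\<in>?U. chi x * cnj (chi y) * \<psi> (x - y)) = (\<Sum>x\<in>?U. chi x * \<psi> ((x - 1) * y))"
    proof (rule sum.reindex_bij_witness[of _ "\<lambda>x. x * y" "\<lambda>x. x / y"])
      fix x assume x: "x \<in> ?U"
      have "chi x = chi (x / y) * chi y" using chi_mult[of "x / y" y] x y by simp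
      moreover have "chi y * cnj (chi y) = 1" using norm[of y] y by (intro norm_1_mult_cnj) auto
      ultimately have "chi x * cnj (chi y) = chi (x / y)" by (simp add: mult.assoc)
      moreover have "(x / y - 1) * y = x - y" using y by (simp add: field_simps)
      ultimately show "chi (x / y) * \<psi> ((x / y - 1) * y) = chi x * cnj (chi y) * \<psi> (x - y)" by simp
    qed (use y in auto)
  qed
  also have "\<dots> = (\<Sum>x\<in>?U. chi x * (\<Sum>y\<in>?U. \<psi> ((x - 1) * y)))"
    unfolding sum_distrib_left by (rule sum.swap)
  also have "\<dots> = (\<Sum>x\<in>?U. (if x = 1 then of_nat CARD('a) else 0) - chi x)"
  proof (rule sum.cong[OF refl])
    fix x :: 'a
    have "(\<Sum>y\<in>UNIV. \<psi> ((x - 1) * y)) = \<psi> ((x - 1) * 0) + (\<Sum>y\<in>?U. \<psi> ((x - 1) * y))"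
      by (rule sum.remove) auto
    hence "(\<Sum>y\<in>?U. \<psi> ((x - 1) * y)) = (if x = 1 then of_nat CARD('a) else 0) - 1"
      unfolding sum_psi_mult by (simp add: psi_0)
    thus "chi x * (\<Sum>y\<in>?U. \<psi> ((x - 1) * y)) = (if x = 1 then of_nat CARD('a) else 0) - chi x"
      by (simp add: chi_1 right_diff_distrib)
  qed
  also have "\<dots> = of_nat CARD('a)" by (simp add: sum_subtractf sum_chi[OF t])
  finally show ?thesis .
qed

end

end

locale index_two_gauss_sums = nontrivial_additive_character \<psi>
  for \<psi> :: "'a :: {finite, field} \<Rightarrow> complex" +
  fixes p1 p2 r M N p f :: nat and \<gamma> :: 'a and chi1 chi2 :: "'a \<Rightarrow> complex"
  assumes p1: "prime p1" and p2: "prime p2"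
    and mod4: "([p1 = 1] (mod 4) \<and> [p2 = 3] (mod 4)) \<or> ([p1 = 3] (mod 4) \<and> [p2 = 1] (mod 4))"
    and M: "M = p1 ^ Suc r" and N: "N = M * p2"
    and p: "prime p" and coprime_pN: "coprime p N"
    and ord_M: "ord M p = totient M" and ord_p2: "ord p2 p = totient p2"
    and f: "f = ord N p" "2 * f = totient N"
    and card: "CARD('a) = p ^ f"
    and \<gamma>: "primitive_element \<gamma>"
    and chi1: "multiplicative_character chi1" "primitive_root_of_unity M (chi1 \<gamma>)"
    and chi2: "multiplicative_character chi2" "primitive_root_of_unity p2 (chi2 \<gamma>)"
    and psi_frobenius: "\<psi> (x ^ p) = \<psi> x"
begin

lemma odd_p1: "odd p1" and odd_p2: "odd p2"
proof -
  have "odd k" if "[k = 1] (mod 4) \<or> [k = 3] (mod 4)" for k :: nat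
    using that unfolding cong_def by auto presburger+
  thus "odd p1" "odd p2" using mod4 by blast+
qed

lemma p1_neq_p2: "p1 \<noteq> p2" using mod4 by (auto simp: cong_def)

lemma coprime_M_p2: "coprime M p2"
  unfolding M coprime_power_left_iff using p1 p2 p1_neq_p2 by (simp add: primes_coprime)

abbreviation "w1 \<equiv> chi1 \<gamma>"
abbreviation "w2 \<equiv> chi2 \<gamma>"

sublocale Z1: primitive_root_prime_power p1 r p M "chi1 \<gamma>"
  using p1 odd_p1 M ord_M chi1 by unfold_locales auto

sublocale Z2: primitive_root_prime_power p2 0 p p2 "chi2 \<gamma>"
  using p2 odd_p2 ord_p2 chi2 by unfold_locales auto

lemma N_pos: "N > 0" using N Z1.n_pos Z2.n_pos by simp

lemma odd_N: "odd N" using odd_p1 odd_p2 by (simp add: N M)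

lemma f_gt_0: "f > 0"
  using f(2) N_pos by (metis gr0I mult_0_right totient_gt_0_iff less_numeral_extra(3))

text \<open>By the Chinese remainder theorem \<open>f\<close> is the lcm of the orders modulo
  \<open>M\<close> and \<open>p2\<close>. As \<open>f\<close> is half their product, the gcd is 2:
  exponents of \<open>p\<close> modulo \<open>M\<close> and modulo \<open>p2\<close> can be
  prescribed independently up to parity.\<close>

lemma gcd_totients: "gcd (totient M) (totient p2) = 2"
proof -
  have cop: "coprime M p" "coprime p2 p" using Z1.coprime_g Z2.coprime_g by auto
  have "p ^ k mod N = 1 mod N \<longleftrightarrow> p ^ k mod M = 1 mod M \<and> p ^ k mod p2 = 1 mod p2" for k
    using coprime_cong_mult_nat[of "p ^ k" 1 M p2] coprime_M_p2 unfolding N cong_def[symmetric]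
    by (metis cong_modulus_mult_nat mult.commute)
  hence "f dvd k \<longleftrightarrow> totient M dvd k \<and> totient p2 dvd k" for k
    using ord_divides[of p k N] ord_divides[of p k M] ord_divides[of p k p2] ord_M ord_p2 f
    by (simp add: cong_def)
  hence "f = lcm (totient M) (totient p2)"
    by (metis dvd_antisym dvd_lcm1 dvd_lcm2 lcm_least dvd_refl)
  hence "f * gcd (totient M) (totient p2) = totient M * totient p2"
    by (simp add: prod_gcd_lcm_nat[symmetric] mult.commute)
  also have "\<dots> = f * 2" using f(2) totient_mult_coprime[OF coprime_M_p2] by (simp add: N mult.commute)
  finally show ?thesis using f_gt_0 by simp
qed

lemma even_f: "even f"
proof -
  have "2 * f = totient M * totient p2" using f(2) totient_mult_coprime[OF coprime_M_p2] by (simp add: N)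
  moreover obtain i j where "totient M = 2 * i" "totient p2 = 2 * j"
    using Z1.even_L Z2.even_L by (meson evenE)
  ultimately show ?thesis by simp
qed

lemma N_dvd: "N dvd CARD('a) - 1"
proof -
  have "[p ^ f = 1] (mod N)" using ord_divides[of p f N] f by simp
  moreover have "p ^ f > 0" using p prime_gt_0_nat by simp
  ultimately show ?thesis unfolding card by (metis cong_altdef_nat less_eq_Suc_le One_nat_def cong_to_1_nat)
qed

lemma \<gamma>_nonzero: "\<gamma> \<noteq> 0" and \<gamma>_power_ex: "x \<noteq> 0 \<Longrightarrow> \<exists>k. x = \<gamma> ^ k"
  using \<gamma> by (auto simp: primitive_element_def)

lemma power_card: "(x :: 'a) ^ (p ^ f) = x"
  using primitive_element_power_card[OF \<gamma>] card by metis

text \<open>The characters are inverted so that \<open>G 1 1\<close> is the Gauss sum given in the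
  theorem.\<close>

definition "alpha x = inverse (chi1 x)"
definition "beta x = inverse (chi2 x)"

lemma alpha_power: "alpha (\<gamma> ^ k) = inverse w1 ^ k" and beta_power: "beta (\<gamma> ^ k) = inverse w2 ^ k"
  using chi_power[OF chi1(1) \<gamma>_nonzero] chi_power[OF chi2(1) \<gamma>_nonzero]
  by (simp_all add: alpha_def beta_def power_inverse)

lemma alpha_root: "x \<noteq> 0 \<Longrightarrow> alpha x ^ M = 1" and beta_root: "x \<noteq> 0 \<Longrightarrow> beta x ^ p2 = 1"
proof -
  assume "x \<noteq> 0"
  then obtain k where k: "x = \<gamma> ^ k" using \<gamma>_power_ex by auto
  have "w1 ^ (k * M) = 1" "w2 ^ (k * p2) = 1"
    using chi1(2) chi2(2) Z1.n_pos Z2.n_pos by (simp_all add: primitive_root_power_eq_1_iff)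
  thus "alpha x ^ M = 1" "beta x ^ p2 = 1" unfolding k alpha_power beta_power
    by (simp_all add: power_mult[symmetric] power_inverse)
qed

lemma norm_alpha: "x \<noteq> 0 \<Longrightarrow> norm (alpha x) = 1" and norm_beta: "x \<noteq> 0 \<Longrightarrow> norm (beta x) = 1"
  using root_of_unity_norm alpha_root beta_root Z1.n_pos Z2.n_pos by blast+

definition "mchar u v x = alpha x ^ u * beta x ^ v"
definition "G u v = gsum (mchar u v)"

lemma mchar: "multiplicative_character (mchar u v)"
  using chi_mult[OF chi1(1)] chi_mult[OF chi2(1)] chi_nonzero[OF chi1(1)] chi_nonzero[OF chi2(1)]
  by (auto simp: multiplicative_character_def mchar_def alpha_def beta_def power_mult_distrib)

lemma norm_mchar: "x \<noteq> 0 \<Longrightarrow> norm (mchar u v x) = 1"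
  by (simp add: mchar_def norm_mult norm_power norm_alpha norm_beta)

text \<open>\<open>N\<close> is odd and divides the order of \<open>\<gamma>\<close>, so -1, whose
  square is 1, lies in the class of index 0. Hence \<open>D\<close> is symmetric and every
  \<open>mchar u v\<close> is trivial at -1.\<close>

lemma minus_one_eq_power: "\<exists>t. N dvd t \<and> - 1 = \<gamma> ^ t"
proof -
  obtain t where t: "- 1 = \<gamma> ^ t" using \<gamma>_power_ex[of "- 1"] by auto
  have "\<gamma> ^ (2 * t) = 1" by (metis mult.commute power_mult power2_minus power_one t)
  hence "CARD('a) - 1 dvd 2 * t" using primitive_element_power_eq_1_iff[OF \<gamma>] by simp
  hence "N dvd 2 * t" using N_dvd dvd_trans by blast
  hence "N dvd t" using odd_N by (simp add: coprime_dvd_mult_right_iff)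
  thus ?thesis using t by blast
qed

lemma mchar_minus_1: "mchar u v (- 1) = 1"
proof -
  obtain t where t: "N dvd t" "- 1 = \<gamma> ^ t" using minus_one_eq_power by auto
  hence "M dvd t" "p2 dvd t" by (auto simp: N intro: dvd_mult_left dvd_mult_right)
  hence "w1 ^ t = 1" "w2 ^ t = 1"
    using chi1(2) chi2(2) Z1.n_pos Z2.n_pos by (simp_all add: primitive_root_power_eq_1_iff)
  thus ?thesis unfolding mchar_def t alpha_power beta_power by (simp add: power_inverse)
qed

lemma G_cong: "[u = u'] (mod M) \<Longrightarrow> [v = v'] (mod p2) \<Longrightarrow> G u v = G u' v'"
proof -
  assume uv: "[u = u'] (mod M)" "[v = v'] (mod p2)"
  have *: "z ^ u = z ^ u'" if "z ^ n = 1" "[u = u'] (mod n)" for z :: complex and u u' n :: nat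
  proof -
    have "z ^ u = z ^ (u mod n)" for u
      by (metis mult_div_mod_eq power_add power_mult power_one that(1) mult.left_neutral)
    thus ?thesis using that(2) by (metis cong_def)
  qed
  show ?thesis unfolding G_def mchar_def
    by (intro gsum_cong arg_cong2[where f="(*)"] *[OF alpha_root] *[OF beta_root] uv)
qed

lemma G_0_0: "G 0 0 = -1"
  unfolding G_def gsum_def mchar_def using sum_psi_nonzero by simp

lemma G_frobenius: "G (p ^ k * u) (p ^ k * v) = G u v"
proof (induction k)
  case (Suc k)
  have "G (p ^ Suc k * u) (p ^ Suc k * v) = gsum (\<lambda>x. mchar (p ^ k * u) (p ^ k * v) x ^ p)"
    unfolding G_def mchar_def by (simp add: power_mult_distrib power_mult[symmetric] mult_ac)
  also have "\<dots> = G (p ^ k * u) (p ^ k * v)" unfolding G_def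
    using gsum_frobenius[OF mchar power_card f_gt_0 prime_gt_0_nat[OF p] psi_frobenius] .
  finally show ?case using Suc by simp
qed simp

lemma cnj_G:
  assumes "M dvd u + u'" "p2 dvd v + v'"
  shows "cnj (G u v) = G u' v'"
proof -
  have *: "cnj z ^ u = z ^ u'" if "z ^ n = 1" "n > 0" "n dvd u + u'" for z :: complex and u u' n :: nat
  proof -
    have "z * cnj z = 1" using root_of_unity_norm[OF that(1,2)] by (rule norm_1_mult_cnj)
    moreover have "z ^ u * z ^ u' = 1" using that by (auto simp: power_add[symmetric] power_mult elim!: dvdE)
    ultimately have "cnj z ^ u * (z ^ u * z ^ u') = cnj z ^ u" "(z * cnj z) ^ u = 1" by simp_all
    hence "cnj z ^ u = (z * cnj z) ^ u * z ^ u'" by (simp only: power_mult_distrib mult_ac)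
    thus ?thesis using \<open>(z * cnj z) ^ u = 1\<close> by simp
  qed
  have "cnj (G u v) = gsum (\<lambda>x. cnj (mchar u v x))"
    unfolding G_def by (intro cnj_gsum mchar mchar_minus_1)
  also have "\<dots> = G u' v'" unfolding G_def mchar_def complex_cnj_mult complex_cnj_power
    by (intro gsum_cong arg_cong2[where f="(*)"] *[OF alpha_root] *[OF beta_root] assms Z1.n_pos Z2.n_pos)
  finally show ?thesis .
qed

lemma G_mult_cnj:
  assumes "\<not> (M dvd u \<and> p2 dvd v)"
  shows "G u v * cnj (G u v) = of_nat (p ^ f)"
proof -
  have "mchar u v \<gamma> \<noteq> 1"
  proof
    assume "mchar u v \<gamma> = 1"
    hence 1: "w1 ^ u * w2 ^ v = 1"
      by (simp add: mchar_def alpha_def beta_def power_inverse flip: inverse_mult_distrib)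
    have "(w1 ^ u * w2 ^ v) ^ p2 = w1 ^ (u * p2) * (w2 ^ p2) ^ v"
      "(w1 ^ u * w2 ^ v) ^ M = w2 ^ (v * M) * (w1 ^ M) ^ u"
      by (simp_all add: power_mult_distrib power_mult[symmetric] mult_ac)
    hence "w1 ^ (u * p2) = 1" "w2 ^ (v * M) = 1"
      using 1 chi1(2) chi2(2) by (simp_all add: primitive_root_of_unity_def)
    hence "M dvd u * p2" "p2 dvd v * M"
      using chi1(2) chi2(2) Z1.n_pos Z2.n_pos by (simp_all add: primitive_root_power_eq_1_iff)
    hence "M dvd u" "p2 dvd v" using coprime_M_p2
      by (simp_all add: coprime_dvd_mult_left_iff coprime_commute)
    thus False using assms by simp
  qed
  thus ?thesis unfolding G_def card[symmetric]
    using norm_mchar \<gamma>_nonzero by (intro gsum_mult_cnj mchar) auto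
qed

lemma real_square_eq:
  assumes "cnj z = z" "z * cnj z = of_nat (p ^ f)"
  obtains e :: int where "e = 1 \<or> e = -1" "z = of_int e * of_nat (p ^ (f div 2))"
proof -
  have "z\<^sup>2 = (of_nat (p ^ (f div 2)))\<^sup>2"
    using assms even_f by (simp add: power2_eq_square power_add[symmetric] mult_2[symmetric])
  hence "z = of_int 1 * of_nat (p ^ (f div 2)) \<or> z = of_int (-1) * of_nat (p ^ (f div 2))"
    by (simp add: power2_eq_iff)
  thus ?thesis using that by blast
qed

lemma G_pure_left:
  obtains e :: int where "e = 1 \<or> e = -1" "\<And>s. G (p ^ s) 0 = of_int e * of_nat (p ^ (f div 2))"
proof -
  have *: "G (p ^ s) 0 = G 1 0" for s using G_frobenius[of s 1 0] by simp
  have "M dvd 1 + p ^ (totient M div 2)" using Z1.g_half_cong by (simp add: cong_0_iff)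
  hence "cnj (G 1 0) = G 1 0" using cnj_G[of 1 "p ^ (totient M div 2)" 0 0] * by simp
  moreover have "G 1 0 * cnj (G 1 0) = of_nat (p ^ f)" using Z1.n_gt_2 by (intro G_mult_cnj) auto
  ultimately show ?thesis using real_square_eq * that by metis
qed

lemma G_pure_right:
  obtains e :: int where "e = 1 \<or> e = -1" "\<And>s. G 0 (p ^ s) = of_int e * of_nat (p ^ (f div 2))"
proof -
  have *: "G 0 (p ^ s) = G 0 1" for s using G_frobenius[of s 0 1] by simp
  have "p2 dvd 1 + p ^ (totient p2 div 2)" using Z2.g_half_cong by (simp add: cong_0_iff)
  hence "cnj (G 0 1) = G 0 1" using cnj_G[of 0 0 1 "p ^ (totient p2 div 2)"] * by simp
  moreover have "G 0 1 * cnj (G 0 1) = of_nat (p ^ f)" using Z2.n_gt_2 by (intro G_mult_cnj) auto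
  ultimately show ?thesis using real_square_eq * that by metis
qed

text \<open>One Frobenius power does both: an exponent congruent to \<open>s\<close> modulo
  \<open>totient M\<close> and to \<open>t\<close> modulo \<open>totient p2\<close> exists because
  \<open>t - s\<close> is divisible by the gcd 2.\<close>

lemma G_even:
  assumes "even (s + t)"
  shows "G (p ^ s) (p ^ t) = G 1 1"
proof -
  \<comment> \<open>A nonnegative representative of \<open>t - s\<close> modulo
    \<open>totient p2\<close>; its parity is that of \<open>s + t\<close>.\<close>
  define d where "d = t + (totient p2 - 1) * s"
  have "even d" using assms Z2.even_L Z2.L_pos by (auto simp: d_def)
  hence "gcd (totient M) (totient p2) dvd d" unfolding gcd_totients .
  then obtain x where x: "[totient M * x = d] (mod totient p2)" using cong_solve_dvd_nat by blast
  have "s + d = t + totient p2 * s" using Z2.L_pos by (cases "totient p2") (auto simp: d_def)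
  hence "[s + totient M * x = t] (mod totient p2)"
    using cong_add[OF cong_refl[of s] x] by (simp add: cong_def)
  hence "[p ^ (s + totient M * x) = p ^ t] (mod p2)" by (simp add: Z2.power_cong_iff)
  moreover have "[p ^ (s + totient M * x) = p ^ s] (mod M)"
    unfolding Z1.power_cong_iff by (simp add: cong_def)
  ultimately have "G (p ^ (s + totient M * x) * 1) (p ^ (s + totient M * x) * 1) = G (p ^ s) (p ^ t)"
    by (intro G_cong) simp_all
  thus ?thesis unfolding G_frobenius by simp
qed

text \<open>Modulo \<open>M\<close>, -1 is \<open>p ^ (totient M div 2)\<close>; modulo
  \<open>p2\<close> it is \<open>p ^ (totient p2 div 2)\<close>. Opposite parities of these
  exponents put it outside the powers of \<open>p\<close> modulo \<open>N\<close>.\<close>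

lemma odd_half_totients: "odd (totient M div 2 + totient p2 div 2)"
  using Z1.even_half_totient_iff Z2.even_half_totient_iff mod4 by (auto simp: cong_def)

lemma G_odd:
  assumes "odd (s + t)"
  shows "G (p ^ s) (p ^ t) = cnj (G 1 1)"
proof -
  have *: "n dvd p ^ s + p ^ (s + h)" if "[p ^ h + 1 = 0] (mod n)" for n s h
  proof -
    have "n dvd p ^ s * (p ^ h + 1)" using that unfolding cong_0_iff by (rule dvd_mult)
    thus ?thesis by (simp add: power_add algebra_simps)
  qed
  have "cnj (G (p ^ s) (p ^ t)) = G (p ^ (s + totient M div 2)) (p ^ (t + totient p2 div 2))"
    by (intro cnj_G * Z1.g_half_cong Z2.g_half_cong)
  also have "\<dots> = G 1 1" using assms odd_half_totients by (intro G_even) auto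
  finally show ?thesis by (metis complex_cnj_cnj)
qed

section \<open>Cyclotomic classes and Gauss periods\<close>

lemma mem_cyclotomic_class: "\<gamma> ^ k \<in> cyclotomic_class \<gamma> N j \<longleftrightarrow> [k = j] (mod N)"
proof
  assume "\<gamma> ^ k \<in> cyclotomic_class \<gamma> N j"
  then obtain i where "\<gamma> ^ k = \<gamma> ^ (j + N * i)"
    by (auto simp: cyclotomic_class_def power_add power_mult)
  hence "[k = j + N * i] (mod (CARD('a) - 1))" using primitive_element_power_eq_iff[OF \<gamma>] by blast
  hence "[k = j + N * i] (mod N)" using N_dvd by (rule cong_dvd_modulus_nat)
  thus "[k = j] (mod N)" by (simp add: cong_def)
next
  assume c: "[k = j] (mod N)"
  \<comment> \<open>Adding \<open>j\<close> multiples of the order of \<open>\<gamma>\<close> leaves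
    the element unchanged and raises the exponent to at least \<open>j\<close>, as the form
    \<open>j + N * i\<close> over the naturals requires.\<close>
  define k' where "k' = k + j * (CARD('a) - 1)"
  have eq: "\<gamma> ^ k = \<gamma> ^ k'" using primitive_element_power_eq_iff[OF \<gamma>] by (simp add: k'_def cong_def)
  have "CARD('a) > 1" unfolding card using f_gt_0 prime_gt_1_nat[OF p] by (metis one_less_power)
  hence "j * 1 \<le> j * (CARD('a) - 1)" by (intro mult_le_mono2) simp
  hence "j \<le> k'" by (simp add: k'_def trans_le_add2)
  moreover have "[j * (CARD('a) - 1) = 0] (mod N)" using N_dvd by (simp add: cong_0_iff)
  hence "[k' = j] (mod N)" using cong_add[OF c, of "j * (CARD('a) - 1)" 0] by (simp add: k'_def)
  ultimately obtain i where "k' = j + N * i"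
    by (metis cong_le_nat cong_sym mult.commute add.commute)
  thus "\<gamma> ^ k \<in> cyclotomic_class \<gamma> N j" unfolding eq
    by (auto simp: cyclotomic_class_def power_add power_mult)
qed

lemma zero_notin_cyclotomic_class: "0 \<notin> cyclotomic_class \<gamma> N j"
  using \<gamma>_nonzero by (auto simp: cyclotomic_class_def)

text \<open>Orthogonality of characters: as \<open>M\<close> and \<open>p2\<close> are coprime, the
  pairs \<open>(u, v)\<close> run through all characters of order dividing \<open>N\<close>, and the
  product of the two geometric series is \<open>N\<close> times the indicator of the class.\<close>

lemma gauss_period:
  "of_nat N * (\<Sum>x\<in>cyclotomic_class \<gamma> N j. \<psi> x) =
     (\<Sum>u<M. \<Sum>v<p2. G u v * w1 ^ (u * j) * w2 ^ (v * j))"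
proof -
  let ?U = "UNIV - {0 :: 'a}"
  have ind: "(\<Sum>u<M. \<Sum>v<p2. mchar u v x * w1 ^ (u * j) * w2 ^ (v * j)) =
      (if x \<in> cyclotomic_class \<gamma> N j then of_nat N else 0)" if x: "x \<in> ?U" for x
  proof -
    obtain k where k: "x = \<gamma> ^ k" using \<gamma>_power_ex[of x] x by auto
    have w0: "w1 \<noteq> 0" "w2 \<noteq> 0" using chi_nonzero chi1 chi2 \<gamma>_nonzero by auto
    define z1 z2 where "z1 = alpha x * w1 ^ j" and "z2 = beta x * w2 ^ j"
    have z: "z1 ^ M = 1" "z2 ^ p2 = 1"
      using chi1(2) chi2(2) x alpha_root beta_root Z1.n_pos Z2.n_pos
      by (simp_all add: z1_def z2_def power_mult_distrib power_mult[symmetric] primitive_root_power_eq_1_iff)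
    have "z1 = 1 \<longleftrightarrow> w1 ^ k = w1 ^ j" "z2 = 1 \<longleftrightarrow> w2 ^ k = w2 ^ j"
      using w0 by (auto simp: z1_def z2_def k alpha_power beta_power power_inverse field_simps)
    hence z': "z1 = 1 \<longleftrightarrow> [k = j] (mod M)" "z2 = 1 \<longleftrightarrow> [k = j] (mod p2)"
      using chi1(2) chi2(2) Z1.n_pos Z2.n_pos by (simp_all add: primitive_root_power_eq_iff)
    have "(\<Sum>u<M. \<Sum>v<p2. mchar u v x * w1 ^ (u * j) * w2 ^ (v * j)) = (\<Sum>u<M. z1 ^ u) * (\<Sum>v<p2. z2 ^ v)"
      unfolding sum_product mchar_def z1_def z2_def
      by (intro sum.cong refl) (simp add: power_mult_distrib power_mult[symmetric] mult_ac)
    also have "\<dots> = (if z1 = 1 \<and> z2 = 1 then of_nat N else 0)"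
      using sum_powers_root_of_unity[OF z(1)] sum_powers_root_of_unity[OF z(2)] by (simp add: N)
    also have "z1 = 1 \<and> z2 = 1 \<longleftrightarrow> [k = j] (mod N)"
      unfolding z' N using coprime_M_p2 coprime_cong_mult_nat
      by (metis cong_modulus_mult_nat mult.commute)
    finally show ?thesis by (simp add: k mem_cyclotomic_class)
  qed
  have "(\<Sum>u<M. \<Sum>v<p2. G u v * w1 ^ (u * j) * w2 ^ (v * j)) =
      (\<Sum>u<M. \<Sum>v<p2. \<Sum>x\<in>?U. \<psi> x * (mchar u v x * w1 ^ (u * j) * w2 ^ (v * j)))"
    unfolding G_def gsum_def sum_distrib_right by (simp add: mult_ac)
  also have "\<dots> = (\<Sum>u<M. \<Sum>x\<in>?U. \<Sum>v<p2. \<psi> x * (mchar u v x * w1 ^ (u * j) * w2 ^ (v * j)))"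
    by (intro sum.cong refl sum.swap)
  also have "\<dots> = (\<Sum>x\<in>?U. \<psi> x * (\<Sum>u<M. \<Sum>v<p2. mchar u v x * w1 ^ (u * j) * w2 ^ (v * j)))"
    unfolding sum_distrib_left by (rule sum.swap)
  also have "\<dots> = (\<Sum>x\<in>?U. \<psi> x * (if x \<in> cyclotomic_class \<gamma> N j then of_nat N else 0))"
    by (intro sum.cong refl) (simp only: ind)
  also have "\<dots> = (\<Sum>x\<in>cyclotomic_class \<gamma> N j. of_nat N * \<psi> x)"
    using zero_notin_cyclotomic_class by (intro sum.mono_neutral_cong_right) auto
  finally show ?thesis by (simp add: sum_distrib_left)
qed

section \<open>Expansion of the character sums of \<open>D\<close>\<close>

abbreviation "C \<equiv> cyclotomic_class \<gamma> N"
abbreviation "K1 k \<equiv> (\<Sum>s<totient M. w1 ^ (p ^ s * k))"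
abbreviation "K2 k \<equiv> (\<Sum>t<totient p2. w2 ^ (p ^ t * k))"
abbreviation "A1 \<equiv> quadratic_sum (totient M) p w1"
abbreviation "A2 \<equiv> quadratic_sum (totient p2) p w2"

definition D :: "'a set" where
  "D = (\<Union>i\<in>{0..<p1 ^ r}. C (i * p2))"

lemma D_power_iff: "\<gamma> ^ k \<in> D \<longleftrightarrow> (\<exists>i<p1 ^ r. [k = i * p2] (mod N))"
  by (auto simp: D_def mem_cyclotomic_class)

lemma D_shift:
  assumes "x \<in> D" "N dvd k"
  shows "\<gamma> ^ k * x \<in> D"
proof -
  have "x \<noteq> 0" using assms zero_notin_cyclotomic_class by (auto simp: D_def)
  then obtain j where j: "x = \<gamma> ^ j" using \<gamma>_power_ex by auto
  obtain i where "i < p1 ^ r" "[j = i * p2] (mod N)" using assms(1) unfolding j D_power_iff by auto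
  moreover have "[k + j = 0 + j] (mod N)" using assms(2) by (intro cong_add) (auto simp: cong_0_iff)
  ultimately have "\<gamma> ^ (k + j) \<in> D" unfolding D_power_iff by (auto intro: cong_trans)
  thus ?thesis by (simp add: j power_add)
qed

lemma zero_notin_D: "0 \<notin> D"
  using zero_notin_cyclotomic_class by (auto simp: D_def)

lemma minus_in_D: "x \<in> D \<Longrightarrow> - x \<in> D"
  using D_shift minus_one_eq_power by (metis mult_minus1)

lemma one_in_D: "1 \<in> D"
  using D_power_iff[of 0] p1 prime_gt_0_nat by (auto intro: exI[of _ 0])

lemma \<gamma>_notin_D: "\<gamma> \<notin> D"
proof
  assume "\<gamma> \<in> D"
  then obtain i where "[1 = i * p2] (mod N)" using D_power_iff[of 1] by auto
  hence "[1 = i * p2] (mod p2)" by (rule cong_dvd_modulus_nat) (simp add: N)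
  thus False using Z2.n_gt_2 by (simp add: cong_def)
qed

lemma char_sum_D:
  "char_sum D (\<gamma> ^ a) = (\<Sum>i<p1 ^ r. \<Sum>x\<in>C (a + i * p2). \<psi> x)"
proof -
  have disj: "C (i * p2) \<inter> C (j * p2) = {}" if ij: "i < p1 ^ r" "j < p1 ^ r" "i \<noteq> j" for i j
  proof (rule ccontr)
    assume "C (i * p2) \<inter> C (j * p2) \<noteq> {}"
    then obtain x where x: "x \<in> C (i * p2)" "x \<in> C (j * p2)" by auto
    then have "x \<noteq> 0" using zero_notin_cyclotomic_class by auto
    then obtain k where "x = \<gamma> ^ k" using \<gamma>_power_ex by auto
    hence "[i * p2 = j * p2] (mod N)" using x mem_cyclotomic_class by (metis cong_sym cong_trans)
    moreover have "i * p2 < N" "j * p2 < N"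
    proof -
      have "p1 ^ r \<le> M" using p1 prime_gt_0_nat[OF p1] by (simp add: M)
      hence "i < M" "j < M" using ij by simp_all
      thus "i * p2 < N" "j * p2 < N" using Z2.n_pos by (simp_all add: N)
    qed
    ultimately have "i * p2 = j * p2" by (simp add: cong_def)
    thus False using ij Z2.n_pos by simp
  qed
  have "char_sum D (\<gamma> ^ a) = (\<Sum>i\<in>{0..<p1 ^ r}. \<Sum>x\<in>C (i * p2). \<psi> (\<gamma> ^ a * x))"
    unfolding char_sum_def D_def using disj by (intro sum.UNION_disjoint) auto
  also have "\<dots> = (\<Sum>i<p1 ^ r. \<Sum>x\<in>C (a + i * p2). \<psi> x)"
  proof (rule sum.cong)
    fix i
    have "C (a + i * p2) = (\<lambda>x. \<gamma> ^ a * x) ` C (i * p2)"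
      unfolding cyclotomic_class_def by (auto simp: power_add mult.assoc image_iff)
    moreover have "inj_on (\<lambda>x. \<gamma> ^ a * x) (C (i * p2))" using \<gamma>_nonzero by (auto simp: inj_on_def)
    ultimately show "(\<Sum>x\<in>C (i * p2). \<psi> (\<gamma> ^ a * x)) = (\<Sum>x\<in>C (a + i * p2). \<psi> x)"
      by (simp add: sum.reindex)
  qed auto
  finally show ?thesis .
qed

text \<open>The union over \<open>i\<close> contributes a geometric series with ratio
  \<open>w1 ^ (u * p2)\<close>. For such \<open>u\<close> the ratio is a \<open>p1 ^ r\<close>-th
  root of unity different from 1, so its \<open>p1 ^ r\<close> terms cancel.\<close>

lemma sum_nonunit_zero:
  assumes "p1 dvd u" "u < M" "u \<noteq> 0"
  shows "(\<Sum>i<p1 ^ r. w1 ^ (u * (a + i * p2))) = 0"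
proof -
  define z where "z = w1 ^ (u * p2)"
  obtain u' where u': "u = p1 * u'" using assms by auto
  have "M dvd u * p2 * p1 ^ r" by (simp add: u' M mult_ac)
  hence "z ^ (p1 ^ r) = 1"
    using chi1(2) Z1.n_pos by (simp add: z_def power_mult[symmetric] primitive_root_power_eq_1_iff)
  moreover have "z \<noteq> 1"
  proof
    assume "z = 1"
    hence "M dvd u * p2" using chi1(2) Z1.n_pos by (simp add: z_def primitive_root_power_eq_1_iff)
    hence "M dvd u" using coprime_M_p2 by (simp add: coprime_dvd_mult_left_iff)
    thus False using assms by (auto dest: dvd_imp_le)
  qed
  ultimately have "(\<Sum>i<p1 ^ r. z ^ i) = 0" by (simp add: sum_powers_root_of_unity)
  moreover have "(\<Sum>i<p1 ^ r. w1 ^ (u * (a + i * p2))) = w1 ^ (u * a) * (\<Sum>i<p1 ^ r. z ^ i)"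
    by (simp add: z_def sum_distrib_left power_add[symmetric] power_mult[symmetric] algebra_simps)
  ultimately show ?thesis by simp
qed

text \<open>\<open>B\<close> and \<open>E\<close> are the parts of the mixed Gauss sum that are
  fixed and negated by a change of coset. \<open>B\<close> therefore meets the plain sums over units
  \<open>K1\<close> and \<open>K2\<close>, while \<open>E\<close> carries the sign
  \<open>(-1) ^ (s + t)\<close> and meets the quadratic sums \<open>A1\<close> and
  \<open>A2\<close>.\<close>

lemma char_sum_D_expand:
  assumes e1: "\<And>s. G (p ^ s) 0 = g1" and e2: "\<And>t. G 0 (p ^ t) = g2"
    and st: "\<And>s t. G (p ^ s) (p ^ t) = B + (- 1) ^ (s + t) * E"
  shows "of_nat N * char_sum D (\<gamma> ^ a) =
     of_nat (p1 ^ r) * (- 1 + g2 * K2 a) + (g1 + B * K2 a) * (\<Sum>i<p1 ^ r. K1 (a + i * p2))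
       + E * A2 a * (\<Sum>i<p1 ^ r. A1 (a + i * p2))"
proof -
  define H where "H u = (\<Sum>v<p2. G u v * w2 ^ (v * a))" for u
  have H: "H u = G u 0 + (\<Sum>t<totient p2. G u (p ^ t) * w2 ^ (p ^ t * a))" for u
  proof -
    have "{v. v < p2 \<and> p2 dvd v} = {0}" using Z2.n_pos by (auto dest: dvd_imp_le)
    hence **: "H u = (\<Sum>t<totient p2. G u (p ^ t mod p2) * w2 ^ (p ^ t mod p2 * a)) + G u 0"
      unfolding H_def Z2.sum_lessThan_units by simp
    have *: "G u (p ^ t mod p2) * w2 ^ (p ^ t mod p2 * a) = G u (p ^ t) * w2 ^ (p ^ t * a)" for t
      by (intro arg_cong2[where f="(*)"] G_cong Z2.w_power_cong) (auto simp: cong_def mod_mult_left_eq)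
    show ?thesis using ** unfolding * by (simp only: add.commute)
  qed
  have H0: "H 0 = - 1 + g2 * K2 a"
    unfolding H e2 G_0_0 by (simp add: sum_distrib_left)
  have Hs: "H (p ^ s) = g1 + B * K2 a + (- 1) ^ s * (E * A2 a)" for s
    unfolding H e1 st quadratic_sum_def distrib_right sum.distrib sum_distrib_left
    by (simp add: power_add mult_ac)
  have Hmod: "H (u mod M) = H u" for u
    unfolding H_def by (intro sum.cong refl arg_cong2[where f="(*)"] G_cong) (auto simp: cong_def)
  have w2: "w2 ^ (v * (a + i * p2)) = w2 ^ (v * a)" for v i
  proof (rule Z2.w_power_cong)
    have "[v * a + v * i * p2 = v * a] (mod p2)" by (simp add: cong_def)
    thus "[v * (a + i * p2) = v * a] (mod p2)" by (simp only: distrib_left mult.assoc)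
  qed
  define S where "S u = (\<Sum>i<p1 ^ r. w1 ^ (u * (a + i * p2)))" for u
  have "of_nat N * char_sum D (\<gamma> ^ a) =
      (\<Sum>i<p1 ^ r. \<Sum>u<M. \<Sum>v<p2. G u v * w1 ^ (u * (a + i * p2)) * w2 ^ (v * (a + i * p2)))"
    unfolding char_sum_D gauss_period[symmetric] sum_distrib_left ..
  also have "\<dots> = (\<Sum>i<p1 ^ r. \<Sum>u<M. H u * w1 ^ (u * (a + i * p2)))"
    unfolding w2 H_def sum_distrib_right by (simp add: mult_ac)
  also have "\<dots> = (\<Sum>u<M. H u * S u)"
    unfolding S_def sum_distrib_left by (rule sum.swap)
  also have "\<dots> = (\<Sum>s<totient M. H (p ^ s mod M) * S (p ^ s mod M)) + (\<Sum>u | u < M \<and> p1 dvd u. H u * S u)"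
    by (rule Z1.sum_lessThan_units)
  \<comment> \<open>Among the nonunits only \<open>u = 0\<close> survives the summation over the
    shifts.\<close>
  also have "(\<Sum>u | u < M \<and> p1 dvd u. H u * S u) = (\<Sum>u\<in>{0}. H u * S u)"
    by (rule sum.mono_neutral_right) (use Z1.n_pos in \<open>auto simp: S_def sum_nonunit_zero\<close>)
  also have "\<dots> = of_nat (p1 ^ r) * (- 1 + g2 * K2 a)" by (simp add: H0 S_def)
  also have "(\<Sum>s<totient M. H (p ^ s mod M) * S (p ^ s mod M)) =
      (\<Sum>s<totient M. (g1 + B * K2 a) * S (p ^ s) + E * A2 a * ((- 1) ^ s * S (p ^ s)))"
  proof (rule sum.cong[OF refl])
    fix s
    have "S (p ^ s mod M) = S (p ^ s)" unfolding S_def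
      by (intro sum.cong refl Z1.w_power_cong) (auto simp: cong_def mod_mult_left_eq)
    thus "H (p ^ s mod M) * S (p ^ s mod M) =
      (g1 + B * K2 a) * S (p ^ s) + E * A2 a * ((- 1) ^ s * S (p ^ s))"
      unfolding Hmod Hs by (simp only: distrib_left distrib_right mult_ac)
  qed
  also have "\<dots> = (g1 + B * K2 a) * (\<Sum>s<totient M. S (p ^ s))
      + E * A2 a * (\<Sum>s<totient M. (- 1) ^ s * S (p ^ s))"
    unfolding sum.distrib sum_distrib_left[where r = "g1 + B * K2 a"]
      sum_distrib_left[where r = "E * A2 a"] ..
  also have "(\<Sum>s<totient M. S (p ^ s)) = (\<Sum>i<p1 ^ r. K1 (a + i * p2))"
    unfolding S_def by (rule sum.swap)
  also have "(\<Sum>s<totient M. (- 1) ^ s * S (p ^ s)) = (\<Sum>i<p1 ^ r. A1 (a + i * p2))"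
    unfolding S_def quadratic_sum_def sum_distrib_left by (rule sum.swap)
  finally show ?thesis by (simp only: add_ac)
qed

text \<open>\<open>p2\<close> is invertible modulo \<open>p1 ^ r\<close>. Both kinds of sums modulo
  \<open>M\<close> vanish unless \<open>p1 ^ r\<close> divides the argument, so this single shift is
  all that remains of the union.\<close>

lemma unique_shift: "\<exists>!i. i < p1 ^ r \<and> p1 ^ r dvd a + i * p2"
proof -
  have pos: "p1 ^ r > 0" using p1 prime_gt_0_nat by simp
  have cop: "coprime p2 (p1 ^ r)" using p1 p2 p1_neq_p2 by (simp add: primes_coprime)
  \<comment> \<open>\<open>(p1 ^ r - 1) * a\<close> stands for \<open>- a\<close> modulo
    \<open>p1 ^ r\<close>.\<close>
  obtain x where x: "[p2 * x = (p1 ^ r - 1) * a] (mod p1 ^ r)"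
    using cong_solve_dvd_nat[of p2 "p1 ^ r"] cop by auto
  have "[a + p2 * x = a + (p1 ^ r - 1) * a] (mod p1 ^ r)" by (intro cong_add x cong_refl)
  moreover have "a + (p1 ^ r - 1) * a = p1 ^ r * a" using pos by (cases "p1 ^ r") simp_all
  ultimately have "p1 ^ r dvd a + p2 * x" by (metis cong_0_iff cong_dvd_iff dvd_triv_left)
  moreover have "[a + (x mod p1 ^ r) * p2 = a + p2 * x] (mod p1 ^ r)"
    unfolding mult.commute[of p2] by (intro cong_add cong_mult) (auto simp: cong_def)
  ultimately have ex: "p1 ^ r dvd a + (x mod p1 ^ r) * p2" using cong_dvd_iff by blast
  show ?thesis
  proof (rule ex1I[of _ "x mod p1 ^ r"])
    fix i assume i: "i < p1 ^ r \<and> p1 ^ r dvd a + i * p2"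
    hence "[a + i * p2 = a + (x mod p1 ^ r) * p2] (mod p1 ^ r)" 
      using ex by (metis cong_0_iff cong_sym cong_trans)
    hence "[i = x mod p1 ^ r] (mod p1 ^ r)"
      using cop by (simp add: cong_add_lcancel_nat cong_mult_rcancel_nat)
    thus "i = x mod p1 ^ r" using i by (simp add: cong_def)
  qed (use ex pos in auto)
qed

text \<open>The counterpart of \<open>delta2\<close> for \<open>p1\<close>:
  \<open>p1 * delta1 a - 1\<close> plays the role of a Ramanujan sum modulo \<open>p1\<close>, taken
  at the one contributing shift.\<close>

definition delta1 :: "nat \<Rightarrow> int" where
  "delta1 a = (if \<exists>i<p1 ^ r. M dvd a + i * p2 then 1 else 0)"

definition delta2 :: "nat \<Rightarrow> int" where
  "delta2 a = (if p2 dvd a then 1 else 0)"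

text \<open>Division by \<open>p1 ^ r\<close> removes the dependence on the exponent: the square is
  0 or \<open>- (p1 * p2)\<close>, as for a product of quadratic Gauss sums modulo \<open>p1\<close>
  and \<open>p2\<close>.\<close>

definition quad_prod :: "nat \<Rightarrow> complex" where
  "quad_prod a = A2 a * (\<Sum>i<p1 ^ r. A1 (a + i * p2)) / of_nat (p1 ^ r)"

lemma delta1_shift:
  obtains i0 where "i0 < p1 ^ r" "p1 ^ r dvd a + i0 * p2"
    "\<And>i. i < p1 ^ r \<Longrightarrow> p1 ^ r dvd a + i * p2 \<Longrightarrow> i = i0"
    "delta1 a = (if M dvd a + i0 * p2 then 1 else 0)"
proof -
  obtain i0 where i0: "i0 < p1 ^ r" "p1 ^ r dvd a + i0 * p2"
    and uniq: "\<And>i. i < p1 ^ r \<Longrightarrow> p1 ^ r dvd a + i * p2 \<Longrightarrow> i = i0" using unique_shift[of a] by auto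
  have dM: "p1 ^ r dvd M" by (simp add: M)
  hence "(\<exists>i<p1 ^ r. M dvd a + i * p2) \<longleftrightarrow> M dvd a + i0 * p2"
    using i0 uniq[OF _ dvd_trans[OF dM]] by blast
  thus ?thesis using that[OF i0 uniq] by (simp add: delta1_def)
qed

lemma K2_eq: "K2 a = of_int (int p2 * delta2 a - 1)"
  using Z2.ramanujan_sum[of a] by (simp add: delta2_def)

lemma sum_K1: "(\<Sum>i<p1 ^ r. K1 (a + i * p2)) = of_nat (p1 ^ r) * of_int (int p1 * delta1 a - 1)"
proof -
  obtain i0 where i0: "i0 < p1 ^ r" "p1 ^ r dvd a + i0 * p2"
    and uniq: "\<And>i. i < p1 ^ r \<Longrightarrow> p1 ^ r dvd a + i * p2 \<Longrightarrow> i = i0"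
    and d: "delta1 a = (if M dvd a + i0 * p2 then 1 else 0)" using delta1_shift[of a] by blast
  have dM: "p1 ^ r dvd M" by (simp add: M)
  have "(\<Sum>i<p1 ^ r. K1 (a + i * p2)) = (\<Sum>i\<in>{i0}. K1 (a + i * p2))"
  proof (rule sum.mono_neutral_right)
    have "K1 (a + i * p2) = 0" if "i < p1 ^ r" "i \<noteq> i0" for i
    proof -
      have "\<not> p1 ^ r dvd a + i * p2" using uniq that by blast
      moreover from this have "\<not> M dvd a + i * p2" using dM dvd_trans by blast
      ultimately show ?thesis by (simp add: Z1.ramanujan_sum)
    qed
    thus "\<forall>i\<in>{..<p1 ^ r} - {i0}. K1 (a + i * p2) = 0" by blast
  qed (use i0 in auto)
  also have "\<dots> = of_nat (p1 ^ r) * of_int (int p1 * delta1 a - 1)"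
    unfolding d using i0 by (simp add: Z1.ramanujan_sum) (simp add: M algebra_simps)
  finally show ?thesis .
qed

text \<open>Each quadratic sum is real or purely imaginary by its behaviour under conjugation, so
  its square is its squared norm up to sign. The two signs are opposite, which is the origin of the
  minus sign.\<close>

lemma quad_prod_power2:
  "(quad_prod a)\<^sup>2 = (if delta1 a = 1 \<or> delta2 a = 1 then 0 else - of_nat (p1 * p2))"
proof -
  obtain i0 where i0: "i0 < p1 ^ r" "p1 ^ r dvd a + i0 * p2"
    and uniq: "\<And>i. i < p1 ^ r \<Longrightarrow> p1 ^ r dvd a + i * p2 \<Longrightarrow> i = i0"
    and d: "delta1 a = (if M dvd a + i0 * p2 then 1 else 0)" using delta1_shift[of a] by blast
  have dM: "p1 ^ r dvd M" by (simp add: M)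
  have p10: "p1 > 0" using p1 prime_gt_0_nat by auto
  have "A1 (a + i * p2) = 0" if "i < p1 ^ r" "i \<noteq> i0" for i
  proof -
    have "\<not> p1 ^ r dvd a + i * p2" using uniq that by blast
    thus ?thesis using Z1.norm_quadratic_sum[of "a + i * p2"] by simp
  qed
  hence "(\<Sum>i<p1 ^ r. A1 (a + i * p2)) = (\<Sum>i\<in>{i0}. A1 (a + i * p2))"
    using i0 by (intro sum.mono_neutral_right) auto
  hence qp: "quad_prod a = A2 a * A1 (a + i0 * p2) / of_nat (p1 ^ r)" by (simp add: quad_prod_def)
  have sq: "z\<^sup>2 = (- 1) ^ h * of_real ((norm z)\<^sup>2)" if "cnj z = (- 1) ^ h * z" for z :: complex and h
  proof -
    have "of_real ((norm z)\<^sup>2) = z * cnj z" by (rule complex_norm_square)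
    hence "(- 1) ^ h * of_real ((norm z)\<^sup>2) = (- 1) ^ h * (- 1) ^ h * (z * z)" unfolding that by simp
    thus ?thesis by (simp add: power2_eq_square flip: power_add)
  qed
  have a1: "(A1 (a + i0 * p2))\<^sup>2 = (- 1) ^ (totient M div 2) * (if delta1 a = 1 then 0 else of_nat (p1 ^ (2 * r + 1)))"
    unfolding sq[OF Z1.cnj_quadratic_sum] Z1.norm_quadratic_sum using i0 by (simp add: d)
  have a2: "(A2 a)\<^sup>2 = (- 1) ^ (totient p2 div 2) * (if delta2 a = 1 then 0 else of_nat p2)"
    unfolding sq[OF Z2.cnj_quadratic_sum] Z2.norm_quadratic_sum by (simp add: delta2_def)
  have "(- 1 :: complex) ^ (totient p2 div 2) * (- 1) ^ (totient M div 2) = - 1"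
    using odd_half_totients by (simp flip: power_add add: add.commute)
  hence sgn: "(- 1 :: complex) ^ (totient p2 div 2) * x * ((- 1) ^ (totient M div 2) * y) = - (x * y)" for x y
    by (metis (no_types, opaque_lifting) mult.assoc mult.left_commute mult_minus1)
  have pw: "(of_nat (p1 ^ (2 * r + 1)) :: complex) = of_nat p1 * (of_nat (p1 ^ r))\<^sup>2"
    by (simp add: power_mult[symmetric] mult.commute)
  show ?thesis unfolding qp power_divide power_mult_distrib a1 a2 sgn pw using p10 by simp
qed

lemma char_sum_D_formula:
  assumes e1: "\<And>s. G (p ^ s) 0 = g1" and e2: "\<And>t. G 0 (p ^ t) = g2"
    and st: "\<And>s t. G (p ^ s) (p ^ t) = B + (- 1) ^ (s + t) * E"
  shows "of_nat (p1 * p2) * char_sum D (\<gamma> ^ a) =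
     - 1 + g2 * of_int (int p2 * delta2 a - 1) + g1 * of_int (int p1 * delta1 a - 1)
       + B * of_int ((int p1 * delta1 a - 1) * (int p2 * delta2 a - 1)) + E * quad_prod a"
proof -
  have p10: "(of_nat (p1 ^ r) :: complex) \<noteq> 0" using p1 prime_gt_0_nat by auto
  have "of_nat (p1 ^ r) * (of_nat (p1 * p2) * char_sum D (\<gamma> ^ a)) = of_nat N * char_sum D (\<gamma> ^ a)"
    by (simp add: N M)
  also have "\<dots> = of_nat (p1 ^ r) * (- 1 + g2 * of_int (int p2 * delta2 a - 1) + g1 * of_int (int p1 * delta1 a - 1)
       + B * of_int ((int p1 * delta1 a - 1) * (int p2 * delta2 a - 1)) + E * quad_prod a)"
    unfolding char_sum_D_expand[OF assms] K2_eq sum_K1 quad_prod_def using p10 by (simp add: field_simps)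
  finally show ?thesis unfolding mult_left_cancel[OF p10] .
qed

text \<open>A common prime factor would be \<open>p1\<close> or \<open>p2\<close> and would make
  \<open>p\<close> congruent to 1 modulo it, whereas \<open>p\<close> is a primitive root modulo
  both primes and these exceed 2.\<close>

lemma coprime_p_minus_1: "coprime N (p - 1)"
proof -
  have *: "coprime P (p - 1)" if "prime P" "P > 2" "ord P p = totient P" for P
  proof (rule ccontr)
    assume "\<not> coprime P (p - 1)"
    hence "P dvd p - 1" using that prime_imp_coprime by blast
    hence "[p = 1] (mod P)" using p prime_ge_1_nat cong_altdef_nat by blast
    hence "ord P p = 1" by (simp add: ord_eq_Suc_0_iff)
    thus False using that totient_prime by simp
  qed
  have "coprime p1 (p - 1)" "coprime p2 (p - 1)"
    using *[OF p1] *[OF p2] Z1.P_ge_3 Z2.P_ge_3 Z1.ord_prime ord_p2 by auto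
  thus ?thesis by (simp add: N M)
qed

text \<open>Since \<open>p - 1\<close> is coprime to \<open>N\<close>, the set \<open>D\<close> is invariant under the multiplicative group of the
  prime field.\<close>

lemma char_sum_D_integral: "\<exists>z :: int. of_nat (p - 1) * char_sum D y = of_int z"
proof -
  have CH: "CHAR('a) = p" using card_power_CHAR[OF card p] .
  have p0: "p > 0" using p prime_gt_0_nat by simp
  have inv: "char_sum D (of_nat j * y) = char_sum D y" if j: "j \<in> {1..<p}" for j
  proof -
    have nd: "\<not> p dvd j" using j by (auto dest: dvd_imp_le)
    hence j0: "(of_nat j :: 'a) \<noteq> 0" by (simp add: of_nat_eq_0_iff_char_dvd CH)
    then obtain k where k: "of_nat j = \<gamma> ^ k" using \<gamma>_power_ex by blast
    have "[j ^ (p - 1) = 1] (mod p)" using fermat_theorem[OF p nd] .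
    hence "(of_nat (j ^ (p - 1)) :: 'a) = of_nat 1" unfolding of_nat_eq_iff_cong_CHAR CH .
    hence "\<gamma> ^ (k * (p - 1)) = 1" by (simp add: k power_mult)
    \<comment> \<open>The order of a nonzero prime-field element divides \<open>p - 1\<close>, which
      is coprime to \<open>N\<close>. So the element is a power of \<open>\<gamma> ^ N\<close>, and
      multiplication by it preserves \<open>D\<close>.\<close>
    hence "N dvd k * (p - 1)" using primitive_element_power_eq_1_iff[OF \<gamma>] N_dvd dvd_trans by blast
    hence Nk: "N dvd k" using coprime_p_minus_1 by (simp add: coprime_dvd_mult_left_iff)
    have sub: "(\<lambda>x. of_nat j * x) ` D \<subseteq> D" using D_shift[OF _ Nk] by (auto simp: k)
    have inj: "inj_on (\<lambda>x. of_nat j * x) D" using j0 by (auto simp: inj_on_def)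
    have "(\<lambda>x. of_nat j * x) ` D = D" using sub inj by (metis card_image card_subset_eq finite)
    hence "char_sum D y = (\<Sum>x\<in>(\<lambda>x. of_nat j * x) ` D. \<psi> (y * x))" by (simp add: char_sum_def)
    also have "\<dots> = char_sum D (of_nat j * y)"
      using inj by (simp add: sum.reindex char_sum_def mult_ac)
    finally show ?thesis ..
  qed
  \<comment> \<open>The sum over the prime field is evaluated twice. Summing over \<open>j\<close>
    first, every \<open>x\<close> gives \<open>p\<close> or 0; by invariance, the terms with
    \<open>j > 0\<close> coincide and \<open>j = 0\<close> gives \<open>card D\<close>.\<close>
  have "(\<Sum>j<p. char_sum D (of_nat j * y)) = (\<Sum>x\<in>D. \<Sum>j<p. \<psi> (y * x) ^ j)"
    unfolding char_sum_def by (subst sum.swap) (simp add: mult.assoc psi_of_nat)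
  also have "\<dots> = (\<Sum>x\<in>D. of_int (if \<psi> (y * x) = 1 then int p else 0))"
  proof (rule sum.cong[OF refl])
    fix x
    have "\<psi> (y * x) ^ p = 1" using psi_of_nat[of p "y * x"] by (simp add: psi_0 CH[symmetric])
    thus "(\<Sum>j<p. \<psi> (y * x) ^ j) = of_int (if \<psi> (y * x) = 1 then int p else 0)"
      by (simp add: sum_powers_root_of_unity)
  qed
  finally have "(\<Sum>j<p. char_sum D (of_nat j * y)) = of_int (\<Sum>x\<in>D. if \<psi> (y * x) = 1 then int p else 0)"
    by simp
  moreover have "(\<Sum>j<p. char_sum D (of_nat j * y)) = of_int (int (card D)) + of_nat (p - 1) * char_sum D y"
  proof -
    have "{..<p} = insert 0 {1..<p}" using p0 by auto
    hence "(\<Sum>j<p. char_sum D (of_nat j * y)) = char_sum D 0 + (\<Sum>j\<in>{1..<p}. char_sum D (of_nat j * y))"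
      by simp
    also have "(\<Sum>j\<in>{1..<p}. char_sum D (of_nat j * y)) = (\<Sum>j\<in>{1..<p}. char_sum D y)"
      by (rule sum.cong[OF refl inv])
    finally show ?thesis by (simp add: char_sum_def psi_0)
  qed
  ultimately have "of_nat (p - 1) * char_sum D y =
      of_int ((\<Sum>x\<in>D. if \<psi> (y * x) = 1 then int p else 0) - int (card D))"
    by (simp add: algebra_simps)
  thus ?thesis by blast
qed

end

section \<open>Eigenvalues\<close>

text \<open>\<open>X0\<close> and \<open>X1\<close> come from two eigenvalues. Modulo
  \<open>P1\<close> their difference is \<open>Q * P2 * (2 * P * e2 - b)\<close>, so
  \<open>b\<close> is congruent to \<open>2 * P * e2\<close>; inserting this into \<open>X1\<close>
  eliminates \<open>b\<close> and \<open>e2\<close> together.\<close>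

lemma pure_sign_arith:
  fixes P1 P2 e1 e2 b Q P :: int
  assumes prime: "prime P1" and ndvd: "\<not> P1 dvd Q" "\<not> P1 dvd P2" "\<not> P1 dvd 2 * P"
    and X0: "P1 dvd - 2 * P + Q * (2 * P * (e1 * (P1 - 1) + e2 * (P2 - 1)) + b * (P1 - 1) * (P2 - 1))"
    and X1: "P1 dvd - 2 * P + Q * (2 * P * (e1 * (P1 - 1) - e2) - b * (P1 - 1))"
  shows "P1 dvd 1 + Q * e1"
proof -
  have "P1 dvd (- 2 * P + Q * (2 * P * (e1 * (P1 - 1) + e2 * (P2 - 1)) + b * (P1 - 1) * (P2 - 1)))
      - (- 2 * P + Q * (2 * P * (e1 * (P1 - 1) - e2) - b * (P1 - 1))) - P1 * (Q * P2 * b)"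
    by (rule dvd_diff[OF dvd_diff[OF X0 X1] dvd_triv_left])
  also have "\<dots> = Q * P2 * (2 * P * e2 - b)" by (simp add: algebra_simps)
  finally have d: "P1 dvd 2 * P * e2 - b"
    using prime ndvd by (simp add: prime_dvd_mult_iff)
  have "P1 dvd (- 2 * P + Q * (2 * P * (e1 * (P1 - 1) - e2) - b * (P1 - 1)))
      + Q * (2 * P * e2 - b) - P1 * (Q * (2 * P * e1 - b))"
    by (rule dvd_diff[OF dvd_add[OF X1 dvd_mult[OF d]] dvd_triv_left])
  also have "\<dots> = - (2 * P * (1 + Q * e1))" by (simp add: algebra_simps)
  finally have "P1 dvd 2 * P * (1 + Q * e1)" by (simp only: dvd_minus_iff)
  thus ?thesis using prime ndvd(3) by (simp only: prime_dvd_mult_iff) simp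
qed

text \<open>\<open>E1\<close>, \<open>E2\<close>, \<open>E3\<close> say that the eigenvalues at
  \<open>M\<close>, \<open>p2\<close> and 0 lie among two values differing in the sign of
  \<open>c\<close>. The first two become formulas for \<open>2 * P * e - b\<close> and
  \<open>2 * P * e + b\<close>, the norm equation links their signs, and the third then forces
  \<open>p1\<close> and \<open>p2\<close> to differ by 2.\<close>

lemma strongly_regular_arith:
  fixes p1 p2 e P b c s1 s2 s3 :: int
  assumes pos: "p1 > 0" "p2 > 0" "P > 0" and e: "e = 1 \<or> e = -1" and c: "c \<noteq> 0" "coprime c P"
    and four: "4 dvd p1 + p2" and s: "s1 = 1 \<or> s1 = -1" "s2 = 1 \<or> s2 = -1" "s3 = 1 \<or> s3 = -1"
    and E1: "2 * P * e * p1 - b * (p1 - 1) = b + s1 * c * (p1 * p2)"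
    and E2: "- 2 * P * e * p2 - b * (p2 - 1) = b + s2 * c * (p1 * p2)"
    and E3: "2 * P * e * (p1 - p2) + b * (p1 - 1) * (p2 - 1) = b + s3 * c * (p1 * p2)"
    and norm: "b\<^sup>2 + p1 * p2 * c\<^sup>2 = 4 * P\<^sup>2"
  shows "b \<in> {1, -1} \<and> c \<in> {1, -1} \<and> p1 = 2 * P + e * b \<and> p2 = 2 * P - e * b"
proof -
  have "p1 * (2 * P * e - b) = p1 * (s1 * c * p2)" using E1 by (simp add: algebra_simps)
  hence F1: "2 * P * e - b = s1 * c * p2" using pos by (subst (asm) mult_left_cancel) auto
  have "p2 * (2 * P * e + b) = p2 * (- s2 * c * p1)" using E2 by (simp add: algebra_simps)
  hence F2: "2 * P * e + b = - s2 * c * p1" using pos by (subst (asm) mult_left_cancel) auto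
  have ee: "e * e = 1" using e by auto
  \<comment> \<open>By the norm equation this product is \<open>p1 * p2 * c\<^sup>2\<close>;
    comparison with the product of \<open>F1\<close> and \<open>F2\<close> ties \<open>s2\<close> to
    \<open>s1\<close>.\<close>
  have "(2 * P * e - b) * (2 * P * e + b) = 4 * P\<^sup>2 * (e * e) - b\<^sup>2"
    by (simp add: algebra_simps power2_eq_square)
  also have "\<dots> = p1 * p2 * c\<^sup>2" using norm ee by simp
  finally have "(p1 * p2 * c\<^sup>2) * (- s1 * s2) = (p1 * p2 * c\<^sup>2) * 1"
    unfolding F1 F2 by (simp add: algebra_simps power2_eq_square)
  hence "- s1 * s2 = 1" using pos c by (subst (asm) mult_left_cancel) auto
  hence s2: "s2 = - s1" using s by auto
  have G1: "4 * P * e = s1 * c * (p1 + p2)" and G2: "2 * b = s1 * c * (p1 - p2)"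
    using F1 F2 unfolding s2 by (simp_all add: algebra_simps)
  have "4 * P * e * (p1 - p2) + 2 * b * ((p1 - 1) * (p2 - 1) - 1) = 2 * s3 * c * (p1 * p2)"
    using E3 by (simp add: algebra_simps)
  hence "s1 * c * (p1 + p2) * (p1 - p2) + s1 * c * (p1 - p2) * ((p1 - 1) * (p2 - 1) - 1)
      = 2 * s3 * c * (p1 * p2)" unfolding G1 G2 .
  hence "(c * p1 * p2) * (s1 * (p1 - p2)) = (c * p1 * p2) * (2 * s3)" by (simp add: algebra_simps)
  hence diff: "s1 * (p1 - p2) = 2 * s3" using pos c by (subst (asm) mult_left_cancel) auto
  have "2 * b = 2 * (c * s3)" using G2 diff by (metis mult.assoc mult.commute mult.left_commute)
  hence b: "b = c * s3" by simp
  \<comment> \<open>Divisibility by 4 absorbs the factor in \<open>4 * P * e\<close>, so that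
    \<open>c\<close> itself divides \<open>P\<close> and, being coprime to it, is a unit.\<close>
  obtain k where k: "p1 + p2 = 4 * k" using four by auto
  have "P * e = s1 * c * k" using G1 k by simp
  hence "P = c * (s1 * k * e)" using ee by (metis mult.assoc mult.commute mult.right_neutral)
  hence "c dvd P" by simp
  hence "is_unit c" using c(2) by (metis coprime_absorb_left)
  hence c1: "c = 1 \<or> c = -1" by auto
  \<comment> \<open>Positivity of \<open>P\<close> and of \<open>p1 + p2\<close> decides the
    remaining sign.\<close>
  have "0 < 4 * P" using pos by simp
  hence "0 < e * (s1 * c) * (p1 + p2)" using G1 ee by (metis mult.assoc mult.commute mult.left_commute mult_1)
  hence "0 < e * (s1 * c)" using pos by (simp add: zero_less_mult_iff)
  hence sc: "s1 * c = e" using c1 s(1) e by auto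
  have "e * p1 = 2 * P * e + b" "e * p2 = 2 * P * e - b" using F1 F2 s2 sc by (simp_all add: mult.assoc)
  hence "p1 = 2 * P + e * b" "p2 = 2 * P - e * b" using e by auto
  thus ?thesis using b c1 s(3) by auto
qed

context index_two_gauss_sums
begin

section \<open>Exponents representing the types of eigenvalues\<close>

lemma deltas_0: "delta1 0 = 1" "delta2 0 = 1"
  using p1 prime_gt_0_nat by (auto simp: delta1_def delta2_def intro: exI[of _ 0])

lemma p2_not_dvd_M: "\<not> p2 dvd M"
  using coprime_M_p2 p2 by (metis coprime_absorb_right not_prime_unit)

lemma deltas_M: "delta1 M = 1" "delta2 M = 0"
  using p1 prime_gt_0_nat p2_not_dvd_M by (auto simp: delta1_def delta2_def intro: exI[of _ 0])

text \<open>The shifts turn \<open>p2\<close> into \<open>(1 + i) * p2\<close> with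
  \<open>1 + i\<close> between 1 and \<open>p1 ^ r < M\<close>, so \<open>M\<close> never divides.
  Adding multiples of \<open>M\<close> leaves the residue modulo \<open>p2\<close> free to
  vary.\<close>

lemma delta1_p2: "delta1 (p2 + x * M) = 0"
proof -
  have "\<not> M dvd p2 + x * M + i * p2" if i: "i < p1 ^ r" for i
  proof
    assume "M dvd p2 + x * M + i * p2"
    hence "M dvd (1 + i) * p2 + x * M" by (simp add: algebra_simps)
    hence "M dvd (1 + i) * p2" by (simp add: dvd_add_left_iff)
    hence "M dvd 1 + i" using coprime_M_p2 by (simp only: coprime_dvd_mult_left_iff)
    hence "M \<le> 1 + i" by (rule dvd_imp_le) simp
    moreover have "1 + i < M"
    proof -
      have "1 + i \<le> p1 ^ r" using i by simp
      also have "\<dots> < M" using Z1.P_ge_3 by (simp add: M)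
      finally show ?thesis .
    qed
    ultimately show False by simp
  qed
  thus ?thesis by (auto simp: delta1_def)
qed

lemma delta2_p2: "delta2 (p2 + x * M) = (if p2 dvd x then 1 else 0)"
  using coprime_M_p2 by (simp add: delta2_def coprime_dvd_mult_left_iff coprime_commute)

text \<open>The two exponents agree modulo \<open>M\<close>, and modulo \<open>p2\<close> they
  differ by the primitive root \<open>p\<close> as a factor, which negates just the sum
  \<open>A2\<close>. This produces both signs of \<open>c\<close> whatever the actual signs of the
  quadratic sums.\<close>

lemma quad_prod_flip: "quad_prod (p2 + p * M) = - quad_prod (p2 + 1 * M)"
proof -
  have "A1 (p2 + p * M + i * p2) = A1 (p2 + 1 * M + i * p2)" for i
    by (intro Z1.quadratic_sum_cong cong_add cong_refl) (simp add: cong_def)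
  moreover have "A2 (p2 + p * M) = A2 (p * M)" "A2 (p2 + 1 * M) = A2 M"
    by (intro Z2.quadratic_sum_cong; simp add: cong_def)+
  ultimately show ?thesis by (simp add: quad_prod_def Z2.quadratic_sum_g)
qed

text \<open>If \<open>h\<close> were odd, the hypotheses would give \<open>p \<equiv> 1\<close> modulo \<open>l\<close>.\<close>

lemma even_exponent:
  assumes "b\<^sup>2 + int (p1 * p2) * c\<^sup>2 = 4 * int p ^ h"
    and "[b = 2 * int p ^ (h div 2)] (mod int l)" and "l \<in> {p1, p2}"
  shows "even h"
proof (rule ccontr)
  assume "odd h"
  then obtain k where k: "h = 2 * k + 1" by (auto elim: oddE)
  have l: "prime l" "l dvd N" "int l dvd int (p1 * p2)" using assms(3) p1 p2 by (auto simp: N M)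
  have "[b\<^sup>2 = (2 * int p ^ k)\<^sup>2] (mod int l)" using cong_pow[OF assms(2), of 2] k by simp
  moreover have "(2 * int p ^ k)\<^sup>2 = 4 * int p ^ (2 * k)"
    by (simp add: power_mult_distrib power_mult[symmetric] mult.commute)
  ultimately have "int l dvd b\<^sup>2 - 4 * int p ^ (2 * k)" by (simp add: cong_iff_dvd_diff)
  hence "int l dvd (b\<^sup>2 - 4 * int p ^ (2 * k)) + int (p1 * p2) * c\<^sup>2"
    using l(3) by (intro dvd_add dvd_mult2)
  also have "\<dots> = 4 * int p ^ (2 * k) * (int p - 1)"
    using assms(1) by (simp add: k algebra_simps)
  finally have "int l dvd int (4 * p ^ (2 * k) * (p - 1))"
    using prime_ge_1_nat[OF p] by (simp add: of_nat_diff)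
  hence "l dvd 4 * p ^ (2 * k) * (p - 1)" by (simp only: int_dvd_int_iff)
  moreover have coprime_l: "coprime l x" if "coprime N x" for x
    using coprime_divisors[OF l(2) dvd_refl that] .
  have "coprime l p" "coprime l (p - 1)" "coprime l 2"
    by (rule coprime_l; use odd_N coprime_pN coprime_p_minus_1 in \<open>simp add: coprime_commute\<close>)+
  hence "coprime l (2 ^ 2 * p ^ (2 * k) * (p - 1))"
    by (simp only: coprime_mult_right_iff coprime_power_right_iff) simp
  hence "coprime l (4 * p ^ (2 * k) * (p - 1))" by simp
  ultimately show False using l(1) by (metis coprime_absorb_left not_prime_unit)
qed

end

text \<open>In the theorem, \<open>P = p ^ (h div 2)\<close> and \<open>t = p powr h\<^sub>0\<close>. The exponent \<open>h\<^sub>0\<close> is not assumed to be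
  nonnegative, hence \<open>t\<close> is real.\<close>

locale index_two_eigenvalues = index_two_gauss_sums \<psi> p1 p2 r M N p f \<gamma> chi1 chi2
  for \<psi> :: "'a :: {finite, field} \<Rightarrow> complex"
    and p1 p2 r M N p f :: nat and \<gamma> :: 'a and chi1 chi2 :: "'a \<Rightarrow> complex" +
  fixes b c :: int and P :: nat and t :: real
  assumes t: "t > 0" and Q: "real (p ^ (f div 2)) = t * real P"
    and P_pos: "P > 0" and coprime_P: "coprime P N"
    and G_1_1: "G 1 1 = (of_int b + of_int c * csqrt (- of_nat (p1 * p2))) / 2 * of_real t"
begin

text \<open>The square root and the two quadratic Gauss sums multiply to an integer; its sign depends on
  \<open>a\<close> and is left undetermined.\<close>

definition root_prod :: "nat \<Rightarrow> int" where
  "root_prod a = (if delta1 a = 1 \<or> delta2 a = 1 then 0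
     else if csqrt (- of_nat (p1 * p2)) * quad_prod a = of_nat (p1 * p2) then int (p1 * p2)
     else - int (p1 * p2))"

lemma root_prod: "csqrt (- of_nat (p1 * p2)) * quad_prod a = of_int (root_prod a)"
proof -
  have "(csqrt (- of_nat (p1 * p2)) * quad_prod a)\<^sup>2 =
      (if delta1 a = 1 \<or> delta2 a = 1 then 0 else (of_nat (p1 * p2))\<^sup>2)"
    unfolding power_mult_distrib quad_prod_power2 power2_csqrt by (simp add: power2_eq_square)
  thus ?thesis unfolding root_prod_def by (auto simp: power2_eq_iff split: if_splits)
qed

text \<open>The character sum after an affine normalisation that removes the factor
  \<open>p1 * p2\<close>, the summand -1 and the real factor \<open>t / 2\<close>, so that comparing
  eigenvalues becomes integer arithmetic. The parameters \<open>e1\<close> and \<open>e2\<close> are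
  the signs of the real Gauss sums.\<close>

definition eigen_int :: "int \<Rightarrow> int \<Rightarrow> nat \<Rightarrow> int" where
  "eigen_int e1 e2 a = 2 * int P * (e1 * (int p1 * delta1 a - 1) + e2 * (int p2 * delta2 a - 1))
     + b * (int p1 * delta1 a - 1) * (int p2 * delta2 a - 1) + c * root_prod a"

lemma char_sum_D_eigen_int_ex:
  obtains e1 e2 :: int where "e1 = 1 \<or> e1 = -1" "e2 = 1 \<or> e2 = -1"
    "\<And>a. of_nat (p1 * p2) * char_sum D (\<gamma> ^ a) = - 1 + of_real (t / 2) * of_int (eigen_int e1 e2 a)"
proof -
  obtain e1 where e1: "e1 = 1 \<or> e1 = -1" "\<And>s. G (p ^ s) 0 = of_int e1 * of_nat (p ^ (f div 2))"
    using G_pure_left by blast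
  obtain e2 where e2: "e2 = 1 \<or> e2 = -1" "\<And>s. G 0 (p ^ s) = of_int e2 * of_nat (p ^ (f div 2))"
    using G_pure_right by blast
  define sr where "sr = csqrt (- of_nat (p1 * p2))"
  \<comment> \<open>The principal root of a negative number is purely imaginary, so conjugating
    \<open>G 1 1\<close> negates only the summand \<open>E\<close>.\<close>
  have cnj_sr: "cnj sr = - sr"
  proof -
    have "sr = csqrt (of_real (- real (p1 * p2)))" by (simp add: sr_def)
    also have "\<dots> = \<i> * of_real (sqrt \<bar>- real (p1 * p2)\<bar>)" by (subst csqrt_of_real_nonpos) auto
    finally show ?thesis by simp
  qed
  define B where "B = of_int b / 2 * complex_of_real t"
  define E where "E = of_int c * sr / 2 * complex_of_real t"
  have G11: "G 1 1 = B + E" "cnj (G 1 1) = B - E"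
    unfolding G_1_1 sr_def[symmetric] B_def E_def using cnj_sr by (simp_all add: field_simps)
  have st: "G (p ^ s) (p ^ t) = B + (- 1) ^ (s + t) * E" for s t
    using G_even[of s t] G_odd[of s t] G11 by (cases "even (s + t)") auto
  have Qc: "(of_nat (p ^ (f div 2)) :: complex) = of_real t * of_nat P"
    using Q by (metis of_real_mult of_real_of_nat_eq)
  have Er: "E * quad_prod a = of_real t / 2 * of_int (c * root_prod a)" for a
    using root_prod[of a] by (simp add: E_def sr_def mult_ac)
  have "of_nat (p1 * p2) * char_sum D (\<gamma> ^ a) = - 1 + of_real (t / 2) * of_int (eigen_int e1 e2 a)" for a
    unfolding char_sum_D_formula[OF e1(2) e2(2) st] Er Qc B_def eigen_int_def
    by (simp add: field_simps)
  thus ?thesis using that e1(1) e2(1) by blast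
qed

text \<open>The integrality of \<open>(p - 1)\<close> times the eigenvalues at \<open>a = 0, M, p2\<close>, where \<open>c\<close> does not occur,
  determines the pure Gauss sums modulo \<open>p1\<close> and \<open>p2\<close>.\<close>

lemma pure_signs:
  assumes e: "e1 = 1 \<or> e1 = -1" "e2 = 1 \<or> e2 = -1"
    and form: "\<And>a. of_nat (p1 * p2) * char_sum D (\<gamma> ^ a) = - 1 + of_real (t / 2) * of_int (eigen_int e1 e2 a)"
  shows "int p1 dvd 1 + int (p ^ (f div 2)) * e1" "int p2 dvd 1 + int (p ^ (f div 2)) * e2"
proof -
  define QQ where "QQ = int (p ^ (f div 2))"
  have Qc: "(of_int QQ :: complex) = of_real t * of_nat P"
    unfolding QQ_def using Q by (metis of_int_of_nat_eq of_real_mult of_real_of_nat_eq)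
  \<comment> \<open>Multiplying by \<open>2 * P\<close> replaces \<open>t / 2\<close> by the integer
    \<open>QQ\<close>, multiplying by \<open>p - 1\<close> makes the character sum integral, and
    \<open>p - 1\<close> is cancelled as it is coprime to \<open>p1 * p2\<close>.\<close>
  have X: "int (p1 * p2) dvd - 2 * int P + QQ * eigen_int e1 e2 a" for a
  proof -
    obtain z where z: "of_nat (p - 1) * char_sum D (\<gamma> ^ a) = of_int z" using char_sum_D_integral by blast
    have "(of_int (- 2 * int P + QQ * eigen_int e1 e2 a) :: complex) =
        2 * of_nat P * (of_nat (p1 * p2) * char_sum D (\<gamma> ^ a))"
      unfolding form by (simp add: Qc algebra_simps)
    hence "(of_int (int (p - 1) * (- 2 * int P + QQ * eigen_int e1 e2 a)) :: complex) =
        2 * of_nat P * of_nat (p1 * p2) * (of_nat (p - 1) * char_sum D (\<gamma> ^ a))"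
      by simp
    also have "\<dots> = of_int (int (p1 * p2) * (2 * int P * z))" unfolding z by simp
    finally have "int (p - 1) * (- 2 * int P + QQ * eigen_int e1 e2 a) = int (p1 * p2) * (2 * int P * z)"
      by (simp only: of_int_eq_iff)
    hence "int (p1 * p2) dvd int (p - 1) * (- 2 * int P + QQ * eigen_int e1 e2 a)" by simp
    moreover have "coprime (int (p1 * p2)) (int (p - 1))"
      using coprime_p_minus_1 by (simp add: N M)
    ultimately show ?thesis by (simp only: coprime_dvd_mult_right_iff)
  qed
  have X1: "int p1 dvd - 2 * int P + QQ * eigen_int e1 e2 a" and
    X2: "int p2 dvd - 2 * int P + QQ * eigen_int e1 e2 a" for a
    using X[of a] by (auto intro: dvd_mult_left dvd_mult_right)
  have E0: "eigen_int e1 e2 0 = 2 * int P * (e1 * (int p1 - 1) + e2 * (int p2 - 1)) + b * (int p1 - 1) * (int p2 - 1)"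
    unfolding eigen_int_def root_prod_def deltas_0 by simp
  have EM: "eigen_int e1 e2 M = 2 * int P * (e1 * (int p1 - 1) - e2) - b * (int p1 - 1)"
    unfolding eigen_int_def root_prod_def deltas_M by simp
  have Ep: "eigen_int e1 e2 p2 = 2 * int P * (e2 * (int p2 - 1) - e1) - b * (int p2 - 1)"
    using delta1_p2[of 0] delta2_p2[of 0] unfolding eigen_int_def root_prod_def by (simp add: algebra_simps)
  have nd: "\<not> int k dvd QQ \<and> \<not> int k dvd 2 * int P" if k: "prime k" "k dvd N" for k
  proof -
    have "\<not> k dvd p" using k p coprime_pN by (metis coprime_common_divisor not_prime_unit)
    hence "\<not> k dvd p ^ (f div 2)" using k prime_dvd_power by blast
    moreover have "\<not> k dvd P" using k coprime_P by (metis coprime_common_divisor not_prime_unit)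
    moreover have "\<not> k dvd 2" using k odd_N by (metis dvd_trans primes_dvd_imp_eq two_is_prime_nat)
    ultimately have "\<not> k dvd p ^ (f div 2)" "\<not> k dvd 2 * P" using k by (auto simp: prime_dvd_mult_iff)
    thus ?thesis unfolding QQ_def by (metis int_dvd_int_iff of_nat_mult of_nat_numeral)
  qed
  have n12: "\<not> int p1 dvd int p2" "\<not> int p2 dvd int p1"
    using p1 p2 p1_neq_p2 by (auto dest: primes_dvd_imp_eq)
  show "int p1 dvd 1 + QQ * e1" 
    by (rule pure_sign_arith[where ?P2.0 = "int p2" and P = "int P" and b = b and ?e2.0 = e2])
      (use p1 nd[of p1] n12 X1[of 0] X1[of M] E0 EM in \<open>auto simp: N M\<close>)
  \<comment> \<open>The same argument with the primes exchanged, and with \<open>p2\<close> in place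
    of \<open>M\<close> as the second exponent.\<close>
  show "int p2 dvd 1 + QQ * e2"
    by (rule pure_sign_arith[where ?P2.0 = "int p1" and P = "int P" and b = b and ?e2.0 = e1])
      (use p2 nd[of p2] n12 X2[of 0] X2[of p2] E0 Ep in \<open>auto simp: N M mult_ac add_ac\<close>)
qed

text \<open>\<open>p ^ (f div 2)\<close> is
  \<open>(p ^ (totient M div 2)) ^ (totient p2 div 2)\<close>, hence
  \<open>(-1) ^ (totient p2 div 2)\<close> modulo \<open>p1\<close>; symmetrically modulo
  \<open>p2\<close>. As both primes exceed 2, the congruences fix the signs, and the residues modulo
  4 express both parities through \<open>p1\<close>.\<close>

lemma pure_signs_eq:
  assumes e: "e1 = 1 \<or> e1 = -1" "e2 = 1 \<or> e2 = -1"
    and form: "\<And>a. of_nat (p1 * p2) * char_sum D (\<gamma> ^ a) = - 1 + of_real (t / 2) * of_int (eigen_int e1 e2 a)"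
  shows "e1 = (- 1) ^ ((p1 - 1) div 2)" "e2 = - ((- 1) ^ ((p1 - 1) div 2))"
proof -
  have ff: "f div 2 = (totient M div 2) * (totient p2 div 2)"
  proof -
    obtain i j where "totient M = 2 * i" "totient p2 = 2 * j"
      using Z1.even_L Z2.even_L by (meson evenE)
    moreover have "2 * f = totient M * totient p2"
      using f(2) totient_mult_coprime[OF coprime_M_p2] by (simp add: N)
    ultimately show ?thesis by simp
  qed
  have *: "e = - ((- 1) ^ j)"
    if "int k dvd 1 + int (p ^ (i * j)) * e" "[p ^ i + 1 = 0] (mod k)" "k > 2" "e = 1 \<or> e = -1" for k i j e
  proof -
    have "int k dvd int (p ^ i + 1)" using that(2) by (simp only: cong_0_iff int_dvd_int_iff)
    hence "[int p ^ i = - 1] (mod int k)" by (simp add: cong_iff_dvd_diff add.commute)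
    hence "[(int p ^ i) ^ j * e = (- 1) ^ j * e] (mod int k)" by (intro cong_mult cong_pow cong_refl)
    hence "[1 + (int p ^ i) ^ j * e = 1 + (- 1) ^ j * e] (mod int k)" by (intro cong_add cong_refl)
    hence "int k dvd 1 + (- 1) ^ j * e" using that(1) by (simp add: power_mult cong_dvd_iff)
    moreover have "(- 1 :: int) ^ j = 1 \<or> (- 1 :: int) ^ j = - 1" by (cases "even j") auto
    ultimately show ?thesis using that(3,4) by (auto dest: zdvd_imp_le)
  qed
  have d: "int p1 dvd 1 + int (p ^ ((totient M div 2) * (totient p2 div 2))) * e1"
     "int p2 dvd 1 + int (p ^ ((totient p2 div 2) * (totient M div 2))) * e2"
    using pure_signs[OF e form] unfolding ff by (simp_all add: mult.commute)
  have "[p ^ (totient M div 2) + 1 = 0] (mod p1)"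
    using Z1.g_half_cong Z1.P_dvd_n by (rule cong_dvd_modulus_nat)
  hence "e1 = - ((- 1) ^ (totient p2 div 2))" using *[OF d(1)] Z1.P_ge_3 e(1) by simp
  moreover have "e2 = - ((- 1) ^ (totient M div 2))" using *[OF d(2) Z2.g_half_cong] Z2.P_ge_3 e(2) by simp
  moreover have "even ((p1 - 1) div 2) \<longleftrightarrow> [p1 = 1] (mod 4)"
    unfolding cong_def using odd_p1 by presburger
  moreover have "[p1 = 1] (mod 4) \<longleftrightarrow> \<not> [p2 = 1] (mod 4)" using mod4 by (auto simp: cong_def)
  ultimately show "e1 = (- 1) ^ ((p1 - 1) div 2)" "e2 = - ((- 1) ^ ((p1 - 1) div 2))"
    using Z1.even_half_totient_iff Z2.even_half_totient_iff by (simp_all add: minus_one_power_iff)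
qed

section \<open>Two-valuedness of the eigenvalues\<close>

abbreviation "\<epsilon> \<equiv> (- 1 :: int) ^ ((p1 - 1) div 2)"
abbreviation "eig \<equiv> eigen_int \<epsilon> (- \<epsilon>)"

lemma char_sum_D_eigen_int:
  "of_nat (p1 * p2) * char_sum D (\<gamma> ^ a) = - 1 + of_real (t / 2) * of_int (eig a)"
proof -
  obtain e1 e2 where *: "e1 = 1 \<or> e1 = -1" "e2 = 1 \<or> e2 = -1"
    "\<And>a. of_nat (p1 * p2) * char_sum D (\<gamma> ^ a) = - 1 + of_real (t / 2) * of_int (eigen_int e1 e2 a)"
    by (rule char_sum_D_eigen_int_ex) blast
  show ?thesis using *(3)[of a] unfolding pure_signs_eq[OF *] .
qed

lemma char_sum_D_eq_iff: "char_sum D (\<gamma> ^ a) = char_sum D (\<gamma> ^ a') \<longleftrightarrow> eig a = eig a'"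
proof -
  have "(of_nat (p1 * p2) :: complex) \<noteq> 0" using Z1.P_ge_3 Z2.P_ge_3 by simp
  hence "char_sum D (\<gamma> ^ a) = char_sum D (\<gamma> ^ a') \<longleftrightarrow>
      of_nat (p1 * p2) * char_sum D (\<gamma> ^ a) = of_nat (p1 * p2) * char_sum D (\<gamma> ^ a')"
    by (rule mult_left_cancel[symmetric])
  thus ?thesis unfolding char_sum_D_eigen_int using t by simp
qed

lemma \<epsilon>_cases: "\<epsilon> = 1 \<or> \<epsilon> = - 1"
  by (cases "even ((p1 - 1) div 2)") auto

lemma strongly_regular_imp:
  assumes srg: "strongly_regular UNIV (cayley_adj D)"
    and c: "c \<noteq> 0" "coprime c (int P)" and norm: "b\<^sup>2 + int (p1 * p2) * c\<^sup>2 = 4 * (int P)\<^sup>2"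
  shows "b \<in> {1, -1} \<and> c \<in> {1, -1} \<and> int p1 = 2 * int P + \<epsilon> * b \<and> int p2 = 2 * int P - \<epsilon> * b"
proof -
  obtain u v where quad: "\<And>y. y \<noteq> 0 \<Longrightarrow> (char_sum D y)\<^sup>2 = u * char_sum D y + v"
    using strongly_regular_imp_quadratic[OF minus_in_D zero_notin_D srg] by blast
  \<comment> \<open>At these two exponents the eigenvalues differ exactly in the sign of \<open>c\<close>.\<close>
  define a1 a2 where "a1 = p2 + 1 * M" and "a2 = p2 + p * M"
  have np: "\<not> p2 dvd p"
    using Z2.coprime_g p2 by (metis coprime_absorb_left not_prime_unit)
  have d1: "delta1 a1 = 0" "delta2 a1 = 0" and d2: "delta1 a2 = 0" "delta2 a2 = 0"
    unfolding a1_def a2_def delta1_p2 delta2_p2 using np Z2.P_ge_3 by auto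
  have "(of_int (root_prod a2) :: complex) = of_int (- root_prod a1)"
    unfolding root_prod[symmetric] of_int_minus a1_def a2_def quad_prod_flip by simp
  hence r2: "root_prod a2 = - root_prod a1" by (simp only: of_int_eq_iff)
  have r1: "root_prod a1 = int (p1 * p2) \<or> root_prod a1 = - int (p1 * p2)"
    by (auto simp: root_prod_def d1)
  have eig1: "eig a1 = b + c * root_prod a1" and eig2: "eig a2 = b - c * root_prod a1"
    unfolding eigen_int_def d1 d2 r2 by simp_all
  have pp: "p1 > 0" "p2 > 0" using Z1.P_ge_3 Z2.P_ge_3 by auto
  have "c * root_prod a1 \<noteq> 0" using c r1 pp by auto
  hence "eig a1 \<noteq> eig a2" unfolding eig1 eig2 by simp
  hence neq: "char_sum D (\<gamma> ^ a1) \<noteq> char_sum D (\<gamma> ^ a2)" by (simp add: char_sum_D_eq_iff)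
  \<comment> \<open>Two distinct roots already determine the quadratic, with \<open>u\<close> as
    their sum, so every further value is one of them.\<close>
  have two: "\<exists>s. (s = 1 \<or> s = - 1) \<and> eig a = b + s * c * (int p1 * int p2)" for a
  proof -
    define x y z where "x = char_sum D (\<gamma> ^ a1)" and "y = char_sum D (\<gamma> ^ a2)" and "z = char_sum D (\<gamma> ^ a)"
    have q: "x\<^sup>2 = u * x + v" "y\<^sup>2 = u * y + v" "z\<^sup>2 = u * z + v"
      unfolding x_def y_def z_def using \<gamma>_nonzero by (intro quad; simp)+
    have "(x - y) * (x + y - u) = (x\<^sup>2 - u * x) - (y\<^sup>2 - u * y)"
      by (simp add: algebra_simps power2_eq_square)
    hence "(x - y) * (x + y - u) = 0" using q by simp
    hence u: "u = x + y" using neq by (simp add: x_def y_def)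
    have "(z - x) * (z - y) = (z\<^sup>2 - u * z) - (x\<^sup>2 - u * x)"
      unfolding u by (simp add: algebra_simps power2_eq_square)
    hence "z = x \<or> z = y" using q by simp
    hence "eig a = eig a1 \<or> eig a = eig a2"
      unfolding x_def y_def z_def by (simp add: char_sum_D_eq_iff)
    thus ?thesis using r1 unfolding eig1 eig2 
      by (auto intro: exI[of _ 1] exI[of _ "- 1"])
  qed
  \<comment> \<open>The exponents 0, \<open>M\<close> and \<open>p2\<close> realise the types
    \<open>(1, 1)\<close>, \<open>(1, 0)\<close> and \<open>(0, 1)\<close> of
    \<open>(delta1, delta2)\<close>, in which \<open>root_prod\<close> vanishes.\<close>
  have E0: "eig 0 = 2 * int P * \<epsilon> * (int p1 - int p2) + b * (int p1 - 1) * (int p2 - 1)"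
    unfolding eigen_int_def root_prod_def deltas_0 by (simp add: algebra_simps)
  have EM: "eig M = 2 * int P * \<epsilon> * int p1 - b * (int p1 - 1)"
    unfolding eigen_int_def root_prod_def deltas_M by (simp add: algebra_simps)
  have Ep: "eig p2 = - 2 * int P * \<epsilon> * int p2 - b * (int p2 - 1)"
    using delta1_p2[of 0] delta2_p2[of 0] unfolding eigen_int_def root_prod_def by (simp add: algebra_simps)
  obtain s1 where s1: "s1 = 1 \<or> s1 = - 1" "eig M = b + s1 * c * (int p1 * int p2)" using two by blast
  obtain s2 where s2: "s2 = 1 \<or> s2 = - 1" "eig p2 = b + s2 * c * (int p1 * int p2)" using two by blast
  obtain s3 where s3: "s3 = 1 \<or> s3 = - 1" "eig 0 = b + s3 * c * (int p1 * int p2)" using two by blast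
  have "p1 mod 4 + p2 mod 4 = 4" using mod4 by (auto simp: cong_def)
  hence "(p1 + p2) mod 4 = 4 mod 4" by (metis mod_add_eq)
  hence "4 dvd p1 + p2" by (simp add: dvd_eq_mod_eq_0)
  hence four: "4 dvd int p1 + int p2" by (metis int_dvd_int_iff of_nat_add of_nat_numeral)
  have norm': "b\<^sup>2 + int p1 * int p2 * c\<^sup>2 = 4 * (int P)\<^sup>2" using norm by simp
  have pos: "int p1 > 0" "int p2 > 0" "int P > 0" using pp P_pos by simp_all
  show ?thesis
    using strongly_regular_arith[OF pos \<epsilon>_cases c four s1(1) s2(1) s3(1)
        s1(2)[unfolded EM] s2(2)[unfolded Ep] s3(2)[unfolded E0] norm'] .
qed

lemma imp_strongly_regular:
  assumes b: "b \<in> {1, -1}" and c: "c \<in> {1, -1}"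
    and p12: "int p1 = 2 * int P + \<epsilon> * b" "int p2 = 2 * int P - \<epsilon> * b"
  shows "strongly_regular UNIV (cayley_adj D)"
proof -
  have "\<epsilon> * \<epsilon> = 1" "b * b = 1" using \<epsilon>_cases b by auto
  hence eq: "\<epsilon> * (\<epsilon> * x) = x" "b * (b * x) = x" for x by (metis mult.assoc mult_1)+
  have eig: "eig a = b + int p1 * int p2 \<or> eig a = b - int p1 * int p2" for a
  proof -
    have d: "delta1 a = 0 \<or> delta1 a = 1" "delta2 a = 0 \<or> delta2 a = 1"
      by (auto simp: delta1_def delta2_def)
    have "root_prod a = int p1 * int p2 \<or> root_prod a = - (int p1 * int p2)"
      if "delta1 a = 0" "delta2 a = 0" using that by (auto simp: root_prod_def)
    hence 00: ?thesis if "delta1 a = 0" "delta2 a = 0"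
      using that c by (auto simp: eigen_int_def)
    have "root_prod a = 0" if "delta1 a = 1 \<or> delta2 a = 1" using that by (auto simp: root_prod_def)
    hence "eig a = 2 * int P * \<epsilon> * (int p1 * delta1 a - int p2 * delta2 a)
       + b * (int p1 * delta1 a - 1) * (int p2 * delta2 a - 1)" if "delta1 a = 1 \<or> delta2 a = 1"
      using that by (simp add: eigen_int_def algebra_simps)
    hence other: "eig a = 2 * int P * \<epsilon> * (int p1 * delta1 a - int p2 * delta2 a)
       + b * (int p1 * delta1 a - 1) * (int p2 * delta2 a - 1)" if "delta1 a = 1 \<or> delta2 a = 1"
      using that by blast
    \<comment> \<open>Sum and difference settle the type \<open>(1, 1)\<close>. The identities
      \<open>m\<close> settle \<open>(1, 0)\<close> and \<open>(0, 1)\<close> by turning the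
      eigenvalue into \<open>b\<close> plus or minus \<open>p1 * p2\<close>.\<close>
    have sum: "int p1 + int p2 = 4 * int P" and diff: "int p1 - int p2 = 2 * (\<epsilon> * b)"
      unfolding p12 by simp_all
    have m: "2 * int P * \<epsilon> - b = \<epsilon> * int p2" "2 * int P * \<epsilon> + b = \<epsilon> * int p1"
      unfolding p12 by (simp_all add: eq distrib_left right_diff_distrib mult_ac)
    have 11: ?thesis if "delta1 a = 1" "delta2 a = 1"
    proof -
      have "eig a = 2 * int P * \<epsilon> * (int p1 - int p2) + b * (int p1 - 1) * (int p2 - 1)"
        using other that by simp
      also have "2 * int P * \<epsilon> * (int p1 - int p2) = b * (4 * int P) * (\<epsilon> * \<epsilon>)" unfolding diff by simp
      also have "\<dots> = b * (int p1 + int p2)" unfolding sum using \<open>\<epsilon> * \<epsilon> = 1\<close> by simp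
      also have "b * (int p1 + int p2) + b * (int p1 - 1) * (int p2 - 1) = b + b * (int p1 * int p2)"
        by (simp add: algebra_simps)
      finally show ?thesis using b by auto
    qed
    have 10: ?thesis if "delta1 a = 1" "delta2 a = 0"
    proof -
      have "eig a = int p1 * (2 * int P * \<epsilon> - b) + b" using other that by (simp add: algebra_simps)
      thus ?thesis unfolding m using \<epsilon>_cases by auto
    qed
    have 01: ?thesis if "delta1 a = 0" "delta2 a = 1"
    proof -
      have "eig a = - (int p2 * (2 * int P * \<epsilon> + b)) + b" using other that by (simp add: algebra_simps)
      thus ?thesis unfolding m using \<epsilon>_cases by auto
    qed
    show ?thesis using d 00 01 10 11 by blast
  qed
  define T where "T x = (- 1 + of_real (t / 2) * of_int x) / (of_nat (p1 * p2) :: complex)" for x :: int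
  have T: "char_sum D (\<gamma> ^ a) = T (eig a)" for a
    using char_sum_D_eigen_int[of a] Z1.P_ge_3 Z2.P_ge_3 unfolding T_def
    by (subst nonzero_eq_divide_eq) (auto simp: mult.commute)
  \<comment> \<open>The images of the two integers under the affine map \<open>T\<close> are the
    roots; their sum and product give the coefficients of the quadratic relation.\<close>
  define x y where "x = T (b + int p1 * int p2)" and "y = T (b - int p1 * int p2)"
  have "(char_sum D z)\<^sup>2 = (x + y) * char_sum D z + (- x * y)" if z: "z \<noteq> 0" for z
  proof -
    obtain a where a: "z = \<gamma> ^ a" using \<gamma>_power_ex z by auto
    have "char_sum D z = x \<or> char_sum D z = y" unfolding a T x_def y_def using eig[of a] by auto
    thus ?thesis by (auto simp: algebra_simps power2_eq_square)
  qed
  thus ?thesis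
    using quadratic_imp_strongly_regular[OF minus_in_D zero_notin_D _ one_in_D \<gamma>_notin_D \<gamma>_nonzero] by blast
qed

end

section \<open>The criterion for the trace character and the prescribed Gauss sum\<close>

theorem corollary5p2:
  fixes p1 p2 m N p f h l :: nat
    and b c :: int
    and \<gamma> :: "'a :: {finite, field}"
    and D :: "'a set"
    and chi1 chi2 :: "'a \<Rightarrow> complex"
    and \<xi> :: complex
  assumes "prime p1" and "prime p2"
    and "([p1 = 1] (mod 4) \<and> [p2 = 3] (mod 4)) \<or> ([p1 = 3] (mod 4) \<and> [p2 = 1] (mod 4))"
    and "m \<ge> 1" and "N = p1 ^ m * p2"
    and "prime p" and "gcd p N = 1"
    and "ord (p1 ^ m) p = totient (p1 ^ m)"
    and "ord p2 p = totient p2"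
    and "f = ord N p" and "real f = real (totient N) / 2"
    and "card (UNIV :: 'a set) = p ^ f"
    and "primitive_element \<gamma>"
    and "D = (\<Union>i\<in>{0..<p1 ^ (m - 1)}. cyclotomic_class \<gamma> N (i * p2))"
    and "multiplicative_character chi1" and "chi1 \<gamma> = exp (2 * of_real pi * \<i> / of_nat (p1 ^ m))"
    and "multiplicative_character chi2" and "chi2 \<gamma> = exp (2 * of_real pi * \<i> / of_nat p2)"
    and "primitive_root_of_unity p \<xi>"
    and "h = class_number (quadratic_field (- int (p1 * p2)))"
    and "l \<in> {p1, p2}" and "[l = 3] (mod 4)"
    and "gauss_sum p f \<xi> (\<lambda>x. inverse (chi1 x) * inverse (chi2 x)) =
           (of_int b + of_int c * csqrt (- of_nat (p1 * p2))) / 2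
             * of_real (real p powr ((real f - real h) / 2))"
    and "\<not> [b = 0] (mod int p)" and "\<not> [c = 0] (mod int p)"
    and "b ^ 2 + int (p1 * p2) * c ^ 2 = 4 * int p ^ h"
    and "[b = 2 * int p ^ (h div 2)] (mod int l)"
  shows "strongly_regular (UNIV :: 'a set) (cayley_adj D) \<longleftrightarrow>
           b \<in> {1, -1} \<and> c \<in> {1, -1} \<and> even h \<and>
           int p1 = 2 * int p ^ (h div 2) + (-1) ^ ((p1 - 1) div 2) * b \<and>
           int p2 = 2 * int p ^ (h div 2) - (-1) ^ ((p1 - 1) div 2) * b"
proof -
  obtain r where r: "m = Suc r" using \<open>m \<ge> 1\<close> by (cases m) auto
  define M where "M = p1 ^ m"
  have p1_pos: "p1 > 0" and p2_pos: "p2 > 0" using \<open>prime p1\<close> \<open>prime p2\<close> by (simp_all add: prime_gt_0_nat)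
  have N: "N = M * p2" using \<open>N = p1 ^ m * p2\<close> by (simp add: M_def)
  have f: "f = ord N p" "2 * f = totient N"
    using \<open>f = ord N p\<close> \<open>real f = real (totient N) / 2\<close> by (simp_all add: field_simps)
  have power_card: "x ^ (p ^ f) = x" for x :: 'a
    using primitive_element_power_card[OF \<open>primitive_element \<gamma>\<close>, of x] \<open>card (UNIV :: 'a set) = p ^ f\<close> by simp
  interpret nontrivial_additive_character "additive_character p f \<xi> :: 'a \<Rightarrow> complex"
    by (rule nontrivial_additive_character) (fact+)
  interpret index_two_gauss_sums "additive_character p f \<xi>" p1 p2 r M N p f \<gamma> chi1 chi2
  proof
    show "primitive_root_of_unity M (chi1 \<gamma>)"
      unfolding \<open>chi1 \<gamma> = _\<close> M_def using p1_pos by (intro primitive_root_exp) simp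
    show "primitive_root_of_unity p2 (chi2 \<gamma>)"
      unfolding \<open>chi2 \<gamma> = _\<close> using p2_pos by (intro primitive_root_exp) simp
    show "coprime p N" unfolding coprime_iff_gcd_eq_1 by fact
    show "additive_character p f \<xi> (x ^ p) = additive_character p f \<xi> x" for x :: 'a
      by (rule additive_character_frobenius) (fact+)
    show "M = p1 ^ Suc r" by (simp add: M_def r)
    show "ord M p = totient M" unfolding M_def by fact
  qed (fact N f | fact)+
  \<comment> \<open>Parity comes before the eigenvalues: both
    \<open>p ^ (f div 2) = t * p ^ (h div 2)\<close> and the rewriting of \<open>p ^ h\<close> as a
    square require the halving of \<open>h\<close> to be exact.\<close>
  have h: "even h"
    using even_exponent[of b c h l] \<open>b ^ 2 + _ = _\<close> \<open>[b = _] (mod int l)\<close> \<open>l \<in> _\<close> by simp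
  define t where "t = real p powr ((real f - real h) / 2)"
  have p0: "p > 0" using \<open>prime p\<close> by (simp add: prime_gt_0_nat)
  interpret index_two_eigenvalues "additive_character p f \<xi>" p1 p2 r M N p f \<gamma> chi1 chi2 b c "p ^ (h div 2)" t
  proof
    show "t > 0" using p0 by (simp add: t_def)
    have "real (f div 2) = (real f - real h) / 2 + real (h div 2)"
      using h even_f by (auto elim!: evenE simp: field_simps)
    hence "real p powr real (f div 2) = t * real p powr real (h div 2)"
      by (simp only: t_def powr_add)
    thus "real (p ^ (f div 2)) = t * real (p ^ (h div 2))" using p0 by (simp add: powr_realpow)
    show "p ^ (h div 2) > 0" using p0 by simp
    show "coprime (p ^ (h div 2)) N" using coprime_pN by simp
    have "G 1 1 = gauss_sum p f \<xi> (\<lambda>x. inverse (chi1 x) * inverse (chi2 x))"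
      by (simp add: G_def gsum_def gauss_sum_def mchar_def alpha_def beta_def)
    thus "G 1 1 = (of_int b + of_int c * csqrt (- of_nat (p1 * p2))) / 2 * of_real t"
      unfolding t_def using \<open>gauss_sum p f \<xi> _ = _\<close> by simp
  qed
  have D: "D = index_two_gauss_sums.D p1 p2 r N \<gamma>"
    using \<open>D = _\<close> by (simp add: D_def r)
  have "prime (int p)" "\<not> int p dvd c"
    using \<open>prime p\<close> \<open>\<not> [c = 0] (mod int p)\<close> by (simp_all only: cong_0_iff prime_nat_int_transfer not_False_eq_True)
  hence "coprime c (int p)" using prime_imp_coprime coprime_commute by blast
  hence c: "c \<noteq> 0" "coprime c (int (p ^ (h div 2)))"
    using \<open>\<not> [c = 0] (mod int p)\<close> by auto
  have "(p ^ (h div 2))\<^sup>2 = p ^ h" using h by (simp flip: power_mult)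
  hence norm: "b\<^sup>2 + int (p1 * p2) * c\<^sup>2 = 4 * (int (p ^ (h div 2)))\<^sup>2"
    using \<open>b ^ 2 + _ = _\<close> by (metis of_nat_power)
  show ?thesis
    using strongly_regular_imp[OF _ c norm] imp_strongly_regular h unfolding D by auto
qed

end
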